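(* Let $K$ be a field, let $E=(E^0,E^1,r,s)$ be a directed graph that satisfies condition (L), let $\mathbb{F}$ be the free group generated by $E^1$, and let $D_0\rtimes_\alpha\mathbb{F}$ be the partial skew group ring associated to $E$ (which is isomorphic to the Leavitt path algebra $L_K(E)$). If $B$ is a $K$-algebra and $\phi:D_0\rtimes_\alpha\mathbb{F}\to B$ is a $K$-algebra homomorphism such that $\phi(1_v\delta_0)\neq0$ for each $v\in E^0$, then $\phi$ is injective.
   Context: Graph conventions. $E^0$ is the set of vertices, $E^1$ the set of edges, $r,s:E^1\to E^0$ the range and source maps. $W$ is the set of finite paths $\xi=\xi_1\cdots\xi_n$ ($n\ge1$, $\xi_i\in E^1$, $r(\xi_i)=s(\xi_{i+1})$), with length $|\xi|=n$, $s(\xi)=s(\xi_1)$, $r(\xi)=r(\xi_n)$; $W^\infty$ is the set of infinite paths $\xi_1\xi_2\cdots$, with $s(\xi)=s(\xi_1)$; for a vertex $v$, $s(v)=r(v)=v$. A sink is a vertex $v$ with $s^{-1}(v)=\emptyset$. Condition (L): every closed path has an exit, i.e. for every $t=t_1\cdots t_m\in W$ with $s(t)=r(t)$ there are $i$ and an edge $f\neq t_i$ with $s(f)=s(t_i)$. The partial action. Let $X=\{\xi\in W:r(\xi)\text{ is a sink}\}\cup\{v\in E^0:v\text{ is a sink}\}\cup W^\infty$. Let $\mathbb{F}$ be the free group on $E^1$, with neutral element denoted $0$. Paths in $W$ are regarded as elements of $\mathbb{F}$. Define $X_0=X$; $X_{b^{-1}}=\{\xi\in X:s(\xi)=r(b)\}$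 for $b\in W$; $X_a=\{\xi\in X:\xi_1\cdots\xi_{|a|}=a\}$ for $a\in W$; $X_{ab^{-1}}=X_a$ for $a,b\in W$ with $r(a)=r(b)$ and $ab^{-1}$ in reduced form; $X_c=\emptyset$ for all other $c\in\mathbb{F}$. Define bijections $\theta_c:X_{c^{-1}}\to X_c$: $\theta_0=\mathrm{id}$; $\theta_b(\xi)=b\xi$ for $b\in W$ (with $\theta_b(r(b))=b$ if $r(b)$ is a sink), and $\theta_{b^{-1}}$ its inverse, which removes the initial segment $b$ (with $\theta_{b^{-1}}(b)=r(b)$ if $r(b)$ is a sink); for $a,b\in W$ with $r(a)=r(b)$ and $ab^{-1}$ reduced, $\theta_{ab^{-1}}(\xi)=a\xi_{|b|+1}\xi_{|b|+2}\cdots$ (replace the initial segment $b$ by $a$); $\theta_c$ is the empty map otherwise. For $c\in\mathbb{F}$ let $F(X_c)$ be the algebra of all functions $X_c\to K$ (identified with the functions $X\to K$ vanishing outside $X_c$), and $\alpha_c:F(X_{c^{-1}})\to F(X_c)$, $\alpha_c(f)=f\circ\theta_{c^{-1}}$. Let $1_c=\chi_{X_c}$ for $c\in\mathbb{F}$, and $1_v=\chi_{X_v}$ with $X_v=\{\xi\in X:s(\xi)=v\}$ for $v\in E^0$. Let $D_0$ be the $K$-linear span of $\{1_p:p\in\mathbb{F}\setminus\{0\}\}\cup\{1_v:v\in E^0\}$ (a commutative $K$-algebra under pointwise operations), and for $p\in\mathbb{F}\setminus\{0\}$ let $D_p=1_pD_0$, which equals the $K$-linear span of $\{1_p1_q:q\in\mathbb{F}\}$.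 The maps $\alpha_p$ satisfy $\alpha_p(1_{p^{-1}}1_q)=1_p1_{pq}$ and restrict to $K$-algebra isomorphisms $\alpha_p:D_{p^{-1}}\to D_p$, giving a partial action $\alpha$ of $\mathbb{F}$ on $D_0$ by ideals $D_p$. The partial skew group ring $D_0\rtimes_\alpha\mathbb{F}$ is the set of finite formal sums $\sum_{t\in\mathbb{F}}a_t\delta_t$ with $a_t\in D_t$, with componentwise addition and multiplication determined by $(a_t\delta_t)(b_s\delta_s)=\alpha_t(\alpha_{t^{-1}}(a_t)b_s)\delta_{ts}$; it is a (not necessarily unital) $K$-algebra, and $\delta_0$ is the symbol of the neutral element of $\mathbb{F}$. *)

theory Defs
  imports
    "Graph_Theory.Arc_Walk"
    "HOL-Algebra.Group"
    "HOL-Library.Sublist"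
    "HOL-Library.Indicator_Function"
    "HOL-Library.Function_Algebras"
    "HOL-Library.Poly_Mapping"
begin

section \<open>The free group on a set\<close>

text \<open>
  A letter \<open>(e, True)\<close> stands for the generator \<open>e\<close> and \<open>(e, False)\<close> for its formal inverse.
  Elements of the free group are reduced words; the product is concatenation followed by
  cancellation, computed by pushing the letters of the first word one by one onto the second.
\<close>

type_synonym 'e letter = "'e \<times> bool"

definition flip :: "'e letter \<Rightarrow> 'e letter" where
  "flip a = (fst a, \<not> snd a)"

definition reduced :: "'e letter list \<Rightarrow> bool" where
  "reduced w \<longleftrightarrow> successively (\<lambda>a b. b \<noteq> flip a) w"

definition push :: "'e letter \<Rightarrow> 'e letter list \<Rightarrow> 'e letter list" where
  "push a w = (if w \<noteq> [] \<and> hd w = flip a then tl w else a # w)"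

definition free_group :: "'e set \<Rightarrow> 'e letter list monoid" where
  "free_group A = \<lparr>carrier = {w. fst ` set w \<subseteq> A \<and> reduced w}, mult = foldr push, one = []\<rparr>"

definition word_inv :: "'e letter list \<Rightarrow> 'e letter list" where
  "word_inv w = rev (map flip w)"

lemma flip_flip [simp]: "flip (flip a) = a"
  by (simp add: flip_def)

lemma fst_flip [simp]: "fst (flip a) = fst a"
  by (simp add: flip_def)

lemma reduced_Nil [simp]: "reduced []"
  by (simp add: reduced_def)

lemma reduced_Cons: "reduced (a # w) \<longleftrightarrow> reduced w \<and> (w = [] \<or> hd w \<noteq> flip a)"
  by (auto simp: reduced_def successively_Cons)

lemma reduced_tl: "reduced w \<Longrightarrow> reduced (tl w)"
  by (cases w) (auto simp: reduced_Cons)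

lemma reduced_push: "reduced w \<Longrightarrow> reduced (push a w)"
  by (auto simp: push_def reduced_Cons reduced_tl)

lemma reduced_foldr_push: "reduced v \<Longrightarrow> reduced (foldr push u v)"
  by (induction u) (auto simp: reduced_push)

lemma set_push: "fst ` set (push a w) \<subseteq> insert (fst a) (fst ` set w)"
  by (cases w) (auto simp: push_def)

lemma set_foldr_push: "fst ` set (foldr push u v) \<subseteq> fst ` set u \<union> fst ` set v"
proof (induction u)
  case (Cons a u)
  have "fst ` set (foldr push (a # u) v) \<subseteq> insert (fst a) (fst ` set (foldr push u v))"
    using set_push[of a "foldr push u v"] by simp
  also have "\<dots> \<subseteq> insert (fst a) (fst ` set u \<union> fst ` set v)"
    using Cons by (rule insert_mono)
  finally show ?case by simp
qed simp

lemma push_push_flip: "reduced w \<Longrightarrow> push a (push (flip a) w) = w"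
  by (cases w) (auto simp: push_def reduced_Cons)

lemma foldr_push_push:
  assumes "reduced v"
  shows "foldr push (push a u) v = push a (foldr push u v)"
proof (cases u)
  case (Cons b u')
  then show ?thesis
    using push_push_flip[OF reduced_foldr_push[OF assms], of a u'] by (auto simp: push_def)
qed (simp add: push_def)

lemma foldr_push_assoc:
  "reduced w \<Longrightarrow> foldr push (foldr push u v) w = foldr push u (foldr push v w)"
  by (induction u) (auto simp: foldr_push_push)

lemma foldr_push_Nil: "reduced u \<Longrightarrow> foldr push u [] = u"
  by (induction u) (auto simp: reduced_Cons push_def)

lemma foldr_push_word_inv: "reduced v \<Longrightarrow> foldr push (word_inv u) (foldr push u v) = v"
proof (induction u)
  case (Cons a u)
  then show ?case
    using push_push_flip[OF reduced_foldr_push[OF \<open>reduced v\<close>], of "flip a" u]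
    by (simp add: word_inv_def)
qed (simp add: word_inv_def)

lemma reduced_word_inv: "reduced (word_inv w) \<longleftrightarrow> reduced w"
proof -
  have "(\<lambda>a b. flip a \<noteq> b) = (\<lambda>a b :: 'a letter. b \<noteq> flip a)"
    by (auto simp: fun_eq_iff)
  then show ?thesis
    unfolding reduced_def word_inv_def successively_rev successively_map flip_flip by metis
qed

lemma word_inv_closed: "w \<in> carrier (free_group A) \<Longrightarrow> word_inv w \<in> carrier (free_group A)"
  by (simp add: free_group_def reduced_word_inv) (simp add: word_inv_def image_image)

lemma word_inv_mult:
  "w \<in> carrier (free_group A) \<Longrightarrow> word_inv w \<otimes>\<^bsub>free_group A\<^esub> w = \<one>\<^bsub>free_group A\<^esub>"
  using foldr_push_word_inv[of "[]" w] by (simp add: free_group_def foldr_push_Nil)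

lemma group_free_group: "group (free_group A)"
proof (rule groupI)
  fix u v assume "u \<in> carrier (free_group A)" "v \<in> carrier (free_group A)"
  then show "u \<otimes>\<^bsub>free_group A\<^esub> v \<in> carrier (free_group A)"
    using subset_trans[OF set_foldr_push[of u v], of A] reduced_foldr_push[of v u]
    by (simp add: free_group_def)
next
  fix w assume "w \<in> carrier (free_group A)"
  then show "\<exists>v\<in>carrier (free_group A). v \<otimes>\<^bsub>free_group A\<^esub> w = \<one>\<^bsub>free_group A\<^esub>"
    using word_inv_closed word_inv_mult by blast
qed (auto simp: free_group_def foldr_push_assoc)

lemma inv_free_group:
  assumes "w \<in> carrier (free_group A)"
  shows "inv\<^bsub>free_group A\<^esub> w = word_inv w"
  using group.inv_equality[OF group_free_group word_inv_mult[OF assms] assms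
      word_inv_closed[OF assms]] .


section \<open>Paths, sinks and condition (L)\<close>

text \<open>
  In \<^typ>\<open>('v, 'e) pre_digraph\<close> the source map is \<^const>\<open>tail\<close> and the range map is \<^const>\<open>head\<close>.
\<close>

definition paths :: "('v, 'e) pre_digraph \<Rightarrow> 'e list set" where
  "paths G = {p. p \<noteq> [] \<and> (\<exists>u v. pre_digraph.awalk G u p v)}"

definition psource :: "('v, 'e) pre_digraph \<Rightarrow> 'e list \<Rightarrow> 'v" where
  "psource G p = tail G (hd p)"

definition prange :: "('v, 'e) pre_digraph \<Rightarrow> 'e list \<Rightarrow> 'v" where
  "prange G p = head G (last p)"

definition inf_paths :: "('v, 'e) pre_digraph \<Rightarrow> (nat \<Rightarrow> 'e) set" where
  "inf_paths G = {\<xi>. \<forall>i. \<xi> i \<in> arcs G \<and> head G (\<xi> i) = tail G (\<xi> (Suc i))}"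

definition sinks :: "('v, 'e) pre_digraph \<Rightarrow> 'v set" where
  "sinks G = {v \<in> verts G. \<not> (\<exists>e\<in>arcs G. tail G e = v)}"

definition condition_L :: "('v, 'e) pre_digraph \<Rightarrow> bool" where
  "condition_L G \<longleftrightarrow> (\<forall>t\<in>paths G. psource G t = prange G t \<longrightarrow>
     (\<exists>i<length t. \<exists>f\<in>arcs G. f \<noteq> t ! i \<and> tail G f = tail G (t ! i)))"


section \<open>The partial action on the boundary path space\<close>

datatype ('v, 'e) bpath = Vertex 'v | FinPath "'e list" | InfPath "nat \<Rightarrow> 'e"

definition bpaths :: "('v, 'e) pre_digraph \<Rightarrow> ('v, 'e) bpath set" where
  "bpaths G = FinPath ` {\<xi> \<in> paths G. prange G \<xi> \<in> sinks G} \<union> Vertex ` sinks G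
     \<union> InfPath ` inf_paths G"

fun bsource :: "('v, 'e) pre_digraph \<Rightarrow> ('v, 'e) bpath \<Rightarrow> 'v" where
  "bsource G (Vertex v) = v"
| "bsource G (FinPath p) = psource G p"
| "bsource G (InfPath \<xi>) = tail G (\<xi> 0)"

fun starts_with :: "'e list \<Rightarrow> ('v, 'e) bpath \<Rightarrow> bool" where
  "starts_with a (Vertex v) \<longleftrightarrow> a = []"
| "starts_with a (FinPath p) \<longleftrightarrow> prefix a p"
| "starts_with a (InfPath \<xi>) \<longleftrightarrow> map \<xi> [0..<length a] = a"

definition path_word :: "'e list \<Rightarrow> 'e letter list" where
  "path_word p = map (\<lambda>e. (e, True)) p"

text \<open>
  The four nontrivial alternatives are mutually exclusive on the free group, since the letters of
  \<open>a\<close> are generators and those of the inverse of \<open>b\<close> are inverses of generators.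
\<close>

definition X_elem :: "('v, 'e) pre_digraph \<Rightarrow> 'e letter list \<Rightarrow> ('v, 'e) bpath set" where
  "X_elem G c = {\<xi> \<in> bpaths G.
      c = []
    \<or> (\<exists>b\<in>paths G. c = word_inv (path_word b) \<and> bsource G \<xi> = prange G b)
    \<or> (\<exists>a\<in>paths G. c = path_word a \<and> starts_with a \<xi>)
    \<or> (\<exists>a\<in>paths G. \<exists>b\<in>paths G. c = path_word a @ word_inv (path_word b) \<and> reduced c
         \<and> prange G a = prange G b \<and> starts_with a \<xi>)}"

definition X_vert :: "('v, 'e) pre_digraph \<Rightarrow> 'v \<Rightarrow> ('v, 'e) bpath set" where
  "X_vert G v = {\<xi> \<in> bpaths G. bsource G \<xi> = v}"

fun prepend :: "'e list \<Rightarrow> ('v, 'e) bpath \<Rightarrow> ('v, 'e) bpath" where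
  "prepend a (Vertex v) = (if a = [] then Vertex v else FinPath a)"
| "prepend a (FinPath p) = FinPath (a @ p)"
| "prepend a (InfPath \<xi>) = InfPath (\<lambda>i. if i < length a then a ! i else \<xi> (i - length a))"

fun remove_initial :: "('v, 'e) pre_digraph \<Rightarrow> 'e list \<Rightarrow> ('v, 'e) bpath \<Rightarrow> ('v, 'e) bpath" where
  "remove_initial G b (Vertex v) = Vertex v"
| "remove_initial G b (FinPath p) =
     (if p = b then Vertex (prange G b) else FinPath (drop (length b) p))"
| "remove_initial G b (InfPath \<xi>) = InfPath (\<lambda>i. \<xi> (i + length b))"

text \<open>
  Every \<open>c\<close> with nonempty \<^term>\<open>X_elem G c\<close> has the form \<open>a b\<^sup>-\<^sup>1\<close> in reduced form with
  \<open>a\<close>, \<open>b\<close> paths or empty; \<open>pos_part\<close> and \<open>neg_part\<close> recover \<open>a\<close> and \<open>b\<close>.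
  The value of \<open>theta G c\<close> is only meaningful on \<open>X_elem G (inv c)\<close>; the usual
  case distinction on \<open>c\<close> is recovered by the lemmas below.
\<close>

definition pos_part :: "'e letter list \<Rightarrow> 'e list" where
  "pos_part c = map fst (takeWhile snd c)"

definition neg_part :: "'e letter list \<Rightarrow> 'e list" where
  "neg_part c = rev (map fst (dropWhile snd c))"

definition theta ::
  "('v, 'e) pre_digraph \<Rightarrow> 'e letter list \<Rightarrow> ('v, 'e) bpath \<Rightarrow> ('v, 'e) bpath" where
  "theta G c \<xi> = prepend (pos_part c) (remove_initial G (neg_part c) \<xi>)"

lemma pos_part_path_word_inv:
  "pos_part (path_word a @ word_inv (path_word b)) = a"
  by (induction a; cases b rule: rev_cases)
    (auto simp: pos_part_def path_word_def word_inv_def flip_def)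

lemma neg_part_path_word_inv:
  "neg_part (path_word a @ word_inv (path_word b)) = b"
  by (induction a; cases b rule: rev_cases)
    (auto simp: neg_part_def path_word_def word_inv_def flip_def rev_map[symmetric] comp_def)

lemma theta_path_inv:
  "theta G (path_word a @ word_inv (path_word b)) \<xi> = prepend a (remove_initial G b \<xi>)"
  by (simp add: theta_def pos_part_path_word_inv neg_part_path_word_inv)

lemma FinPath_Nil_notin: "FinPath [] \<notin> bpaths G"
  by (auto simp: bpaths_def paths_def)

lemma remove_initial_Nil: "\<xi> \<in> bpaths G \<Longrightarrow> remove_initial G [] \<xi> = \<xi>"
  using FinPath_Nil_notin[of G] by (cases \<xi>) auto

lemma prepend_Nil: "prepend [] \<xi> = \<xi>"
  by (cases \<xi>) auto

lemma theta_one: "\<xi> \<in> bpaths G \<Longrightarrow> theta G [] \<xi> = \<xi>"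
  by (simp add: theta_def pos_part_def neg_part_def remove_initial_Nil prepend_Nil)

lemma theta_path: "\<xi> \<in> bpaths G \<Longrightarrow> theta G (path_word a) \<xi> = prepend a \<xi>"
  using theta_path_inv[of G a "[]" \<xi>]
  by (simp add: remove_initial_Nil path_word_def word_inv_def)

lemma theta_inv_path: "theta G (word_inv (path_word b)) \<xi> = remove_initial G b \<xi>"
  using theta_path_inv[of G "[]" b \<xi>] by (simp add: prepend_Nil path_word_def)

lemma X_elem_one: "X_elem G [] = bpaths G"
  by (auto simp: X_elem_def)

lemma X_elem_path:
  assumes "a \<in> paths G"
  shows "X_elem G (path_word a) = {\<xi> \<in> bpaths G. starts_with a \<xi>}"
proof -
  have ne: "b \<noteq> []" if "b \<in> paths G" for b
    using that by (auto simp: paths_def)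
  have inj: "path_word a = path_word b \<longleftrightarrow> a = b" for b
    by (auto simp: path_word_def inj_map_eq_map inj_def)
  have "path_word a \<noteq> w @ word_inv (path_word b)" if "b \<in> paths G" for w b
  proof
    assume eq: "path_word a = w @ word_inv (path_word b)"
    have "(last b, False) \<in> set (word_inv (path_word b))"
      using ne[OF that] by (force simp: word_inv_def path_word_def flip_def)
    then have "(last b, False) \<in> set (path_word a)"
      using eq by simp
    then show False by (auto simp: path_word_def)
  qed
  from this[of _ "[]"] this show ?thesis
    using assms ne[OF assms] inj unfolding X_elem_def
    by (auto simp: path_word_def)
qed


section \<open>The partial skew group ring\<close>

text \<open>
  Functions \<open>X\<^sub>c \<rightarrow> K\<close> are represented as functions on the whole type that vanish outside \<open>X\<^sub>c\<close>;
  sums and products of functions are the pointwise ones of \<^theory>\<open>HOL-Library.Function_Algebras\<close>.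
\<close>

definition fun_scale :: "'k::field \<Rightarrow> ('x \<Rightarrow> 'k) \<Rightarrow> 'x \<Rightarrow> 'k" where
  "fun_scale c f = (\<lambda>x. c * f x)"

lemma vector_space_fun_scale: "vector_space fun_scale"
  by unfold_locales (auto simp: fun_scale_def fun_eq_iff algebra_simps)

definition alpha ::
  "('v, 'e) pre_digraph \<Rightarrow> 'e letter list \<Rightarrow> (('v, 'e) bpath \<Rightarrow> 'k::field) \<Rightarrow> ('v, 'e) bpath \<Rightarrow> 'k"
  where
  "alpha G c f = (\<lambda>\<xi>. if \<xi> \<in> X_elem G c then f (theta G (inv\<^bsub>free_group (arcs G)\<^esub> c) \<xi>) else 0)"

definition D0 :: "('v, 'e) pre_digraph \<Rightarrow> (('v, 'e) bpath \<Rightarrow> 'k::field) set" where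
  "D0 G = module.span fun_scale
     ({indicator (X_elem G p) |p. p \<in> carrier (free_group (arcs G)) - {\<one>\<^bsub>free_group (arcs G)\<^esub>}}
      \<union> {indicator (X_vert G v) |v. v \<in> verts G})"

definition D :: "('v, 'e) pre_digraph \<Rightarrow> 'e letter list \<Rightarrow> (('v, 'e) bpath \<Rightarrow> 'k::field) set" where
  "D G p = (if p = \<one>\<^bsub>free_group (arcs G)\<^esub> then D0 G else (\<lambda>f. indicator (X_elem G p) * f) ` D0 G)"

text \<open>
  A finite formal sum of terms \<open>a\<^sub>t \<delta>\<^sub>t\<close> is the finitely supported map sending \<open>t\<close> to \<open>a\<^sub>t\<close>,
  and \<open>a \<delta>\<^sub>t\<close> is \<^term>\<open>Poly_Mapping.single t a\<close>. Addition is that of \<^type>\<open>poly_mapping\<close>.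
\<close>

type_synonym ('v, 'e, 'k) skew = "'e letter list \<Rightarrow>\<^sub>0 (('v, 'e) bpath \<Rightarrow> 'k)"

definition skew_ring :: "('v, 'e) pre_digraph \<Rightarrow> ('v, 'e, 'k::field) skew set" where
  "skew_ring G = {x. \<forall>t\<in>Poly_Mapping.keys x.
     t \<in> carrier (free_group (arcs G)) \<and> Poly_Mapping.lookup x t \<in> D G t}"

definition skew_mult ::
  "('v, 'e) pre_digraph \<Rightarrow> ('v, 'e, 'k::field) skew \<Rightarrow> ('v, 'e, 'k) skew \<Rightarrow> ('v, 'e, 'k) skew" where
  "skew_mult G x y = (\<Sum>t\<in>Poly_Mapping.keys x. \<Sum>s\<in>Poly_Mapping.keys y.
     Poly_Mapping.single (t \<otimes>\<^bsub>free_group (arcs G)\<^esub> s)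
       (alpha G t (alpha G (inv\<^bsub>free_group (arcs G)\<^esub> t) (Poly_Mapping.lookup x t)
          * Poly_Mapping.lookup y s)))"

definition skew_scale :: "'k::field \<Rightarrow> ('v, 'e, 'k) skew \<Rightarrow> ('v, 'e, 'k) skew" where
  "skew_scale c x = Poly_Mapping.map (fun_scale c) x"


section \<open>Algebras and their homomorphisms\<close>

text \<open>
  Associative algebras, not necessarily commutative or unital: the class \<^class>\<open>ring\<close> has no unit.
\<close>

locale k_algebra = vector_space scale
  for scale :: "'k::field \<Rightarrow> 'b::ring \<Rightarrow> 'b" +
  assumes scale_mult_left: "scale c x * y = scale c (x * y)"
    and mult_scale_right: "x * scale c y = scale c (x * y)"

text \<open>Values of the homomorphism outside the carrier \<^term>\<open>skew_ring G\<close> are irrelevant.\<close>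

definition skew_ring_hom ::
  "('v, 'e) pre_digraph \<Rightarrow> ('k::field \<Rightarrow> 'b::ring \<Rightarrow> 'b) \<Rightarrow> (('v, 'e, 'k) skew \<Rightarrow> 'b) \<Rightarrow> bool" where
  "skew_ring_hom G scale \<phi> \<longleftrightarrow>
     (\<forall>x\<in>skew_ring G. \<forall>y\<in>skew_ring G. \<phi> (x + y) = \<phi> x + \<phi> y) \<and>
     (\<forall>x\<in>skew_ring G. \<forall>y\<in>skew_ring G. \<phi> (skew_mult G x y) = \<phi> x * \<phi> y) \<and>
     (\<forall>c. \<forall>x\<in>skew_ring G. \<phi> (skew_scale c x) = scale c (\<phi> x))"

end

theory Submission
  imports Defs
begin

text \<open>
  Let \<open>x \<noteq> 0\<close> lie in the kernel of \<open>\<phi>\<close>, and let \<open>f\<close> be a nonzero coefficient of \<open>x\<close>, at the group element \<open>t\<close>.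
  Functions in \<open>D\<^sub>0\<close> depend only on finitely many edges of a boundary path, so \<open>f\<close> takes a constant value
  \<open>k \<noteq> 0\<close> on a cylinder set. The plan is to choose a smaller cylinder \<open>C\<close>, around some \<open>\<xi>\<close>, that separates
  \<open>t\<close> from the other group elements \<open>s\<close> in the support of \<open>x\<close>: with \<open>C'\<close> a cylinder around the image of \<open>\<xi>\<close>
  under the map of \<open>t\<^sup>-\<^sup>1\<close>, no such \<open>s\<close> has an inverse that moves a point of \<open>C\<close> into \<open>C'\<close>. Then
  multiplying \<open>x\<close> by \<open>1\<^sub>C \<delta>\<^sub>0\<close> on the left and by the indicator of \<open>C'\<close>, cut down to the domain of the map of \<open>t\<close> and
  placed at \<open>t\<^sup>-\<^sup>1\<close>, on the right kills all terms but one and leaves \<open>k 1\<^sub>C \<delta>\<^sub>0\<close> (lemma \<open>skew_mult_collapse\<close>).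

  A group element whose map is not empty has the form \<open>a b\<^sup>-\<^sup>1\<close> for possibly empty paths \<open>a\<close>, \<open>b\<close>. If \<open>s = a' b'\<^sup>-\<^sup>1\<close>
  and \<open>t = a b\<^sup>-\<^sup>1\<close> act alike near \<open>\<xi>\<close>, comparing edges shows that either a tail of \<open>\<xi>\<close> agrees with a shift of
  itself over a long range, or \<open>(a, b)\<close> and \<open>(a', b')\<close> differ by a common suffix, and then they are equal
  because the words are reduced (lemma \<open>quot_word_eq_if_edges_agree\<close>). So it suffices that no early tail of
  \<open>\<xi>\<close> has a small period. Condition (L) makes such \<open>\<xi>\<close> dense (lemma \<open>exists_aperiodic_in_cyl\<close>): an
  eventually periodic path runs around a closed path for ever, and it can be made to leave through an exit
  as late as desired.

  Thus \<open>\<phi> (1\<^sub>C \<delta>\<^sub>0) = 0\<close>. But \<open>C\<close> is either \<open>X\<^sub>v\<close> for a vertex \<open>v\<close> or the set of boundary paths that start with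
  a path \<open>\<nu>\<close>, and in the second case the projection \<open>1\<^sub>C \<delta>\<^sub>0\<close> is equivalent to the one of the range of \<open>\<nu>\<close>.
  Either way \<open>\<phi>\<close> would vanish on some \<open>1\<^sub>v \<delta>\<^sub>0\<close> (lemma \<open>hom_indicator_cyl_neq_0\<close>), against the hypothesis.
\<close>

section \<open>Boundary paths as sequences of edges\<close>

text \<open>
  A uniform view of the three kinds of boundary path: a partial sequence of edges. Removing or prepending
  an initial segment becomes an index shift.
\<close>

fun edge_at :: "('v, 'e) bpath \<Rightarrow> nat \<Rightarrow> 'e option" where
  "edge_at (Vertex v) i = None"
| "edge_at (FinPath p) i = (if i < length p then Some (p ! i) else None)"
| "edge_at (InfPath \<xi>) i = Some (\<xi> i)"

lemma starts_with_iff: "starts_with a \<xi> \<longleftrightarrow> (\<forall>i<length a. edge_at \<xi> i = Some (a ! i))"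
proof (cases \<xi>)
  case (FinPath p)
  have "prefix a p \<longleftrightarrow> (\<forall>i<length a. i < length p \<and> p ! i = a ! i)"
  proof
    assume r: "\<forall>i<length a. i < length p \<and> p ! i = a ! i"
    then have "length a \<le> length p"
      by (meson leI less_irrefl)
    then have "a = take (length a) p"
      using r by (intro nth_equalityI) auto
    then show "prefix a p"
      by (metis take_is_prefix)
  qed (auto simp: prefix_def nth_append)
  then show ?thesis using FinPath by auto
next
  case (InfPath x)
  then show ?thesis
    using list_eq_iff_nth_eq[of "map x [0..<length a]" a] by simp
qed auto

lemma edge_at_prepend:
  "edge_at (prepend a \<xi>) i = (if i < length a then Some (a ! i) else edge_at \<xi> (i - length a))"
  by (cases \<xi>) (auto simp: nth_append)

lemma edge_at_remove_initial:
  "starts_with a \<xi> \<Longrightarrow> edge_at (remove_initial G a \<xi>) i = edge_at \<xi> (i + length a)"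
  by (cases \<xi>) (auto simp: add.commute)

context wf_digraph
begin

text \<open>Adjacency of consecutive edges is easier to split and append than walks with named endpoints.\<close>

lemma mem_paths_iff:
  "p \<in> paths G \<longleftrightarrow>
     p \<noteq> [] \<and> set p \<subseteq> arcs G \<and> successively (\<lambda>e f. head G e = tail G f) p"
proof -
  have "awalk (tail G (hd p)) p (head G (last p))"
    if "p \<noteq> []" "set p \<subseteq> arcs G" "successively (\<lambda>e f. head G e = tail G f) p" for p
    using that
  proof (induction p)
    case (Cons e p)
    then show ?case
      by (cases p) (auto simp: awalk_simps successively_Cons)
  qed simp
  moreover have "set p \<subseteq> arcs G \<and> successively (\<lambda>e f. head G e = tail G f) p \<and> (p \<noteq> [] \<longrightarrow> tail G (hd p) = u)"
    if "awalk u p v" for u v p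
    using that
  proof (induction p arbitrary: u)
    case (Cons e p)
    then show ?case
      by (cases p) (auto simp: awalk_simps successively_Cons)
  qed simp
  ultimately show ?thesis
    unfolding paths_def by blast
qed

lemma Vertex_in_bpaths [simp]: "Vertex v \<in> bpaths G \<longleftrightarrow> v \<in> sinks G"
  and FinPath_in_bpaths [simp]: "FinPath p \<in> bpaths G \<longleftrightarrow> p \<in> paths G \<and> prange G p \<in> sinks G"
  and InfPath_in_bpaths [simp]: "InfPath x \<in> bpaths G \<longleftrightarrow> x \<in> inf_paths G"
  by (auto simp: bpaths_def)

lemma paths_append:
  "\<lbrakk>a \<noteq> []; b \<noteq> []\<rbrakk> \<Longrightarrow>
     a @ b \<in> paths G \<longleftrightarrow> a \<in> paths G \<and> b \<in> paths G \<and> prange G a = psource G b"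
  by (auto simp: mem_paths_iff successively_append_iff prange_def psource_def)

lemma paths_inf_path:
  assumes "x \<in> inf_paths G" "n > 0"
  shows "map x [0..<n] \<in> paths G"
  using assms unfolding mem_paths_iff inf_paths_def
  by (auto simp: successively_conv_nth)

lemma bsource_in_verts: "\<xi> \<in> bpaths G \<Longrightarrow> bsource G \<xi> \<in> verts G"
  by (cases \<xi>)
    (auto simp: sinks_def psource_def mem_paths_iff inf_paths_def intro!: tail_in_verts)

text \<open>
  Removing an initial segment \<open>a\<close> and prepending it are mutually inverse between the boundary paths
  that start with \<open>a\<close> and those that start at the range of \<open>a\<close>: this lemma and the next.
\<close>

lemma remove_initial:
  assumes \<xi>: "\<xi> \<in> bpaths G" and a: "starts_with a \<xi>"
  shows remove_initial_in_bpaths: "remove_initial G a \<xi> \<in> bpaths G"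
    and prepend_remove_initial: "prepend a (remove_initial G a \<xi>) = \<xi>"
    and path_if_starts_with: "a \<noteq> [] \<Longrightarrow> a \<in> paths G"
    and bsource_remove_initial:
      "a \<noteq> [] \<Longrightarrow> bsource G (remove_initial G a \<xi>) = prange G a"
proof -
  have "remove_initial G a \<xi> \<in> bpaths G \<and> prepend a (remove_initial G a \<xi>) = \<xi> \<and>
    (a \<noteq> [] \<longrightarrow> a \<in> paths G \<and> bsource G (remove_initial G a \<xi>) = prange G a)"
  proof (cases "a = []")
    case True
    then show ?thesis using \<xi> by (simp add: remove_initial_Nil prepend_Nil)
  next
    case ne: False
    show ?thesis
    proof (cases \<xi>)
      case (FinPath p)
      then obtain q where p: "p = a @ q"
        using a by (auto simp: prefix_def)
      show ?thesis
        using \<xi> ne FinPath p by (cases "q = []") (auto simp: paths_append prange_def)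
    next
      case (InfPath x)
      have x: "\<And>i. x i \<in> arcs G \<and> head G (x i) = tail G (x (Suc i))"
        using \<xi> InfPath by (simp add: inf_paths_def)
      have xa: "map x [0..<length a] = a"
        using a InfPath by simp
      have nth: "a ! i = x i" if "i < length a" for i
        using arg_cong[OF xa, of "\<lambda>l. l ! i"] that by simp
      have "a \<in> paths G"
        using paths_inf_path[of x "length a"] \<xi> InfPath ne xa by simp
      moreover have "head G (last a) = tail G (x (length a))"
        using ne x[of "length a - 1"] nth[of "length a - 1"] by (simp add: last_conv_nth)
      ultimately show ?thesis
        using \<xi> InfPath x nth by (auto simp: inf_paths_def prange_def fun_eq_iff)
    qed (use a ne in simp)
  qed
  then show "remove_initial G a \<xi> \<in> bpaths G" "prepend a (remove_initial G a \<xi>) = \<xi>"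
    "a \<noteq> [] \<Longrightarrow> a \<in> paths G"
    "a \<noteq> [] \<Longrightarrow> bsource G (remove_initial G a \<xi>) = prange G a"
    by auto
qed

lemma prepend:
  assumes \<eta>: "\<eta> \<in> bpaths G" and a: "a = [] \<or> a \<in> paths G \<and> prange G a = bsource G \<eta>"
  shows prepend_in_bpaths: "prepend a \<eta> \<in> bpaths G"
    and remove_initial_prepend: "remove_initial G a (prepend a \<eta>) = \<eta>"
    and starts_with_prepend: "starts_with a (prepend a \<eta>)"
    and bsource_prepend: "bsource G (prepend a \<eta>) = (if a = [] then bsource G \<eta> else psource G a)"
proof -
  show "starts_with a (prepend a \<eta>)"
    by (simp add: starts_with_iff edge_at_prepend)
  have "prepend a \<eta> \<in> bpaths G \<and> remove_initial G a (prepend a \<eta>) = \<eta> \<and>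
     bsource G (prepend a \<eta>) = (if a = [] then bsource G \<eta> else psource G a)"
  proof (cases "a = []")
    case True
    then show ?thesis using \<eta> by (simp add: remove_initial_Nil prepend_Nil)
  next
    case ne: False
    show ?thesis
    proof (cases \<eta>)
      case (FinPath p)
      then have "p \<noteq> []"
        using \<eta> by (auto simp: mem_paths_iff)
      then show ?thesis
        using \<eta> ne a FinPath by (auto simp: paths_append psource_def prange_def)
    next
      case (InfPath x)
      have x: "\<And>i. x i \<in> arcs G \<and> head G (x i) = tail G (x (Suc i))"
        using \<eta> InfPath by (simp add: inf_paths_def)
      have ap: "set a \<subseteq> arcs G" "successively (\<lambda>e f. head G e = tail G f) a"
        and la: "head G (a ! (length a - 1)) = tail G (x 0)"
        using a ne InfPath by (auto simp: mem_paths_iff prange_def last_conv_nth)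
      have "(if i < length a then a ! i else x (i - length a)) \<in> arcs G" for i
        using ap x by (auto simp: subset_iff)
      moreover have "head G (if i < length a then a ! i else x (i - length a)) =
          tail G (if Suc i < length a then a ! Suc i else x (Suc i - length a))" for i
      proof -
        consider "Suc i < length a" | "Suc i = length a" | "length a \<le> i" by linarith
        then show ?thesis
        proof cases
          case 1
          then show ?thesis using ap(2) by (simp add: successively_conv_nth)
        next
          case 2
          then have "length a - 1 = i" by simp
          then show ?thesis using 2 la by simp
        next
          case 3
          then show ?thesis using x[of "i - length a"] by (simp add: Suc_diff_le)
        qed
      qed
      ultimately have "(\<lambda>i. if i < length a then a ! i else x (i - length a)) \<in> inf_paths G"
        unfolding inf_paths_def by blast
      then show ?thesis
        using InfPath ne by (simp add: psource_def hd_conv_nth)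
    qed (use a \<eta> ne in auto)
  qed
  then show "prepend a \<eta> \<in> bpaths G" "remove_initial G a (prepend a \<eta>) = \<eta>"
    "bsource G (prepend a \<eta>) = (if a = [] then bsource G \<eta> else psource G a)"
    by auto
qed

end

section \<open>The partial action in terms of pairs of paths\<close>

text \<open>
  The group element \<open>a b\<^sup>-\<^sup>1\<close>. Empty \<open>a\<close> or \<open>b\<close> is included, so that all nonempty sets
  \<^term>\<open>X_elem G c\<close> and all their maps are treated by one formula.
\<close>

definition quot_word :: "'e list \<Rightarrow> 'e list \<Rightarrow> 'e letter list" where
  "quot_word a b = path_word a @ word_inv (path_word b)"

lemma word_inv_path_word: "word_inv (path_word b) = map (\<lambda>e. (e, False)) (rev b)"
  by (simp add: word_inv_def path_word_def flip_def rev_map comp_def)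

lemma quot_word_Nil_right: "quot_word a [] = path_word a"
  and quot_word_Nil_left: "quot_word [] b = word_inv (path_word b)"
  by (simp_all add: quot_word_def path_word_def word_inv_def)

lemma quot_word_inject: "quot_word a b = quot_word a' b' \<longleftrightarrow> a = a' \<and> b = b'"
  unfolding quot_word_def by (metis pos_part_path_word_inv neg_part_path_word_inv)

lemma length_quot_word: "length (quot_word a b) = length a + length b"
  by (simp add: quot_word_def word_inv_path_word) (simp add: path_word_def)

lemma word_inv_quot_word: "word_inv (quot_word a b) = quot_word b a"
  by (simp add: quot_word_def word_inv_def rev_map comp_def)

lemma reduced_quot_word_iff:
  "reduced (quot_word a b) \<longleftrightarrow> a = [] \<or> b = [] \<or> last a \<noteq> last b"
proof -
  have "successively (\<lambda>_ _. True) w" for w :: "'e list"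
    by (simp add: successively_conv_nth)
  then show ?thesis
    unfolding reduced_def quot_word_def word_inv_path_word
    by (auto simp: path_word_def successively_append_iff successively_map flip_def
        last_map hd_map hd_rev)
qed

lemma mem_X_elem_iff:
  "\<zeta> \<in> X_elem G c \<longleftrightarrow> \<zeta> \<in> bpaths G \<and> (c = quot_word [] []
    \<or> (\<exists>b\<in>paths G. c = quot_word [] b \<and> bsource G \<zeta> = prange G b)
    \<or> (\<exists>a\<in>paths G. c = quot_word a [] \<and> starts_with a \<zeta>)
    \<or> (\<exists>a\<in>paths G. \<exists>b\<in>paths G. c = quot_word a b \<and> reduced c
         \<and> prange G a = prange G b \<and> starts_with a \<zeta>))"
  by (simp add: X_elem_def quot_word_def path_word_def word_inv_def)

context wf_digraph
begin

text \<open>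
  The four clauses in the definition of the domains collapse to one: the remainder of \<open>\<zeta>\<close> after \<open>a\<close> can
  be attached to \<open>b\<close>. For \<open>b = []\<close> there is nothing to attach to, hence the disjunction.
\<close>

lemma mem_X_elem_quot_word_iff:
  assumes "reduced (quot_word a b)"
  shows "\<zeta> \<in> X_elem G (quot_word a b) \<longleftrightarrow> \<zeta> \<in> bpaths G \<and> starts_with a \<zeta> \<and>
    (b = [] \<or> b \<in> paths G \<and> prange G b = bsource G (remove_initial G a \<zeta>))"
proof -
  have "\<zeta> \<in> X_elem G (quot_word a b) \<longleftrightarrow> \<zeta> \<in> bpaths G \<and>
     (a = [] \<and> b = [] \<or> b \<in> paths G \<and> a = [] \<and> bsource G \<zeta> = prange G b
    \<or> a \<in> paths G \<and> b = [] \<and> starts_with a \<zeta>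
    \<or> a \<in> paths G \<and> b \<in> paths G \<and> prange G a = prange G b \<and> starts_with a \<zeta>)"
    using assms unfolding mem_X_elem_iff by (auto simp: quot_word_inject)
  moreover have "[] \<notin> paths G"
    by (simp add: mem_paths_iff)
  moreover have "starts_with [] \<zeta>" "\<zeta> \<in> bpaths G \<Longrightarrow> remove_initial G [] \<zeta> = \<zeta>"
    by (simp_all add: starts_with_iff remove_initial_Nil)
  ultimately show ?thesis
    using bsource_remove_initial[of \<zeta> a] path_if_starts_with[of \<zeta> a]
    by (cases "a = []") auto
qed

lemma X_elem_quot_wordE:
  assumes "\<zeta> \<in> X_elem G c"
  obtains a b where "c = quot_word a b"
  using assms that unfolding mem_X_elem_iff by blast

text \<open>
  For \<open>c = a b\<^sup>-\<^sup>1\<close>, the map of \<open>c\<^sup>-\<^sup>1\<close> exchanges the initial segment \<open>a\<close> for \<open>b\<close>, and that of \<open>c\<close> exchanges it back.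
\<close>

lemma theta_word_inv:
  assumes "reduced c" and \<zeta>: "\<zeta> \<in> X_elem G c"
  shows theta_word_inv_in: "theta G (word_inv c) \<zeta> \<in> X_elem G (word_inv c)"
    and theta_theta_word_inv: "theta G c (theta G (word_inv c) \<zeta>) = \<zeta>"
proof -
  obtain a b where c: "c = quot_word a b"
    using X_elem_quot_wordE[OF \<zeta>] .
  let ?\<eta> = "remove_initial G a \<zeta>"
  have \<zeta>': "\<zeta> \<in> bpaths G" "starts_with a \<zeta>" "b = [] \<or> b \<in> paths G \<and> prange G b = bsource G ?\<eta>"
    using \<zeta> assms(1) by (simp_all add: c mem_X_elem_quot_word_iff)
  have \<theta>: "theta G (word_inv c) \<zeta> = prepend b ?\<eta>"
    by (simp add: c word_inv_quot_word) (simp add: quot_word_def theta_path_inv)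
  have \<eta>: "?\<eta> \<in> bpaths G"
    by (rule remove_initial_in_bpaths[OF \<zeta>'(1,2)])
  have "reduced (quot_word b a)"
    using assms(1) by (auto simp: c reduced_quot_word_iff)
  then show "theta G (word_inv c) \<zeta> \<in> X_elem G (word_inv c)"
    unfolding \<theta> unfolding c word_inv_quot_word
    using prepend[OF \<eta> \<zeta>'(3)] path_if_starts_with[OF \<zeta>'(1,2)]
      bsource_remove_initial[OF \<zeta>'(1,2)]
    by (auto simp: mem_X_elem_quot_word_iff)
  have "theta G c (prepend b ?\<eta>) = prepend a ?\<eta>"
    unfolding c quot_word_def theta_path_inv
    by (simp add: remove_initial_prepend[OF \<eta> \<zeta>'(3)])
  then show "theta G c (theta G (word_inv c) \<zeta>) = \<zeta>"
    unfolding \<theta> by (simp add: prepend_remove_initial[OF \<zeta>'(1,2)])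
qed

lemma edges_theta_word_inv:
  assumes "reduced (quot_word a b)" and \<zeta>: "\<zeta> \<in> X_elem G (quot_word a b)"
  shows "starts_with a \<zeta>" "starts_with b (theta G (quot_word b a) \<zeta>)"
    "edge_at (theta G (quot_word b a) \<zeta>) (i + length b) = edge_at \<zeta> (i + length a)"
proof -
  have \<zeta>': "\<zeta> \<in> bpaths G" "starts_with a \<zeta>"
    "b = [] \<or> b \<in> paths G \<and> prange G b = bsource G (remove_initial G a \<zeta>)"
    using \<zeta> assms(1) by (simp_all add: mem_X_elem_quot_word_iff)
  have \<theta>: "theta G (quot_word b a) \<zeta> = prepend b (remove_initial G a \<zeta>)"
    by (simp add: quot_word_def theta_path_inv)
  show "starts_with a \<zeta>" by fact
  show "starts_with b (theta G (quot_word b a) \<zeta>)"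
    "edge_at (theta G (quot_word b a) \<zeta>) (i + length b) = edge_at \<zeta> (i + length a)"
    using \<zeta>' by (simp_all add: \<theta> starts_with_iff edge_at_prepend edge_at_remove_initial)
qed

lemma bsource_theta_word_inv:
  assumes "reduced (quot_word a b)" and \<zeta>: "\<zeta> \<in> X_elem G (quot_word a b)"
  shows "bsource G (theta G (quot_word b a) \<zeta>) =
    (if b \<noteq> [] then psource G b else if a \<noteq> [] then prange G a else bsource G \<zeta>)"
proof -
  have \<zeta>': "\<zeta> \<in> bpaths G" "starts_with a \<zeta>"
    "b = [] \<or> b \<in> paths G \<and> prange G b = bsource G (remove_initial G a \<zeta>)"
    using \<zeta> assms(1) by (simp_all add: mem_X_elem_quot_word_iff)
  have "theta G (quot_word b a) \<zeta> = prepend b (remove_initial G a \<zeta>)"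
    by (simp add: quot_word_def theta_path_inv)
  then show ?thesis
    using bsource_prepend[OF remove_initial_in_bpaths[OF \<zeta>'(1,2)] \<zeta>'(3)]
      bsource_remove_initial[OF \<zeta>'(1,2)] \<zeta>'(1)
    by (auto simp: remove_initial_Nil)
qed

lemma X_elem_word_inv_path_word:
  assumes b: "b \<in> paths G"
  shows "X_elem G (word_inv (path_word b)) = X_vert G (prange G b)"
proof -
  have "reduced (quot_word [] b)"
    by (simp add: reduced_quot_word_iff)
  from mem_X_elem_quot_word_iff[OF this] show ?thesis
    using b unfolding quot_word_Nil_left set_eq_iff
    by (auto simp: X_vert_def starts_with_iff remove_initial_Nil mem_paths_iff)
qed

end

section \<open>Cylinder sets\<close>

text \<open>
  The source is part of the condition because a path without edges, or \<open>n = 0\<close>, does not determine it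
  through the edges.
\<close>

definition cyl :: "('v, 'e) pre_digraph \<Rightarrow> ('v, 'e) bpath \<Rightarrow> nat \<Rightarrow> ('v, 'e) bpath set" where
  "cyl G \<xi> n = {\<eta> \<in> bpaths G. bsource G \<eta> = bsource G \<xi> \<and> (\<forall>i<n. edge_at \<eta> i = edge_at \<xi> i)}"

context wf_digraph
begin

lemma Vertex_if_bsource_sink:
  "\<lbrakk>\<eta> \<in> bpaths G; bsource G \<eta> \<in> sinks G\<rbrakk> \<Longrightarrow> \<eta> = Vertex (bsource G \<eta>)"
  by (cases \<eta>) (auto simp: sinks_def mem_paths_iff psource_def inf_paths_def dest: hd_in_set)

lemma bsource_if_starts_with:
  assumes "\<eta> \<in> bpaths G" "starts_with a \<eta>" "a \<noteq> []"
  shows "bsource G \<eta> = psource G a"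
  using bsource_prepend[OF remove_initial_in_bpaths[OF assms(1,2)], of a] assms
    path_if_starts_with[OF assms(1,2)] bsource_remove_initial[OF assms(1,2)]
  by (simp add: prepend_remove_initial)

text \<open>
  A cylinder around a path with at least \<open>n\<close> edges fixes the first \<open>n\<close> of them. If \<open>\<xi>\<close> is shorter it ends in a
  sink, and the cylinder is \<open>{\<xi>}\<close>, which is also the set of boundary paths that start with \<open>\<xi>\<close>.
\<close>

lemma cyl_cases:
  assumes \<xi>: "\<xi> \<in> bpaths G"
  obtains (vert) "cyl G \<xi> n = X_vert G (bsource G \<xi>)"
  | (path) \<nu> where "\<nu> \<in> paths G" "cyl G \<xi> n = X_elem G (path_word \<nu>)"
proof -
  have X: "\<exists>\<nu>\<in>paths G. cyl G \<xi> n = X_elem G (path_word \<nu>)"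
    if \<nu>: "\<nu> \<noteq> []" "starts_with \<nu> \<xi>" "length \<nu> \<le> n"
      "length \<nu> < n \<Longrightarrow> prange G \<nu> \<in> sinks G" for \<nu>
  proof -
    have path: "\<nu> \<in> paths G"
      using path_if_starts_with[OF \<xi> \<nu>(2,1)] .
    have "\<eta> \<in> cyl G \<xi> n \<longleftrightarrow> starts_with \<nu> \<eta>" if \<eta>: "\<eta> \<in> bpaths G" for \<eta>
    proof
      assume "\<eta> \<in> cyl G \<xi> n"
      then show "starts_with \<nu> \<eta>"
        using \<nu> by (auto simp: cyl_def starts_with_iff)
    next
      assume st: "starts_with \<nu> \<eta>"
      show "\<eta> \<in> cyl G \<xi> n"
      proof (cases "length \<nu> < n")
        case True
        have end_Vertex: "remove_initial G \<nu> \<zeta> = Vertex (prange G \<nu>)"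
          if "\<zeta> \<in> bpaths G" "starts_with \<nu> \<zeta>" for \<zeta>
          using Vertex_if_bsource_sink[OF remove_initial_in_bpaths[OF that]] \<nu>(4)[OF True]
            bsource_remove_initial[OF that \<nu>(1)] by simp
        have "\<eta> = \<xi>"
          using prepend_remove_initial[OF \<eta> st] prepend_remove_initial[OF \<xi> \<nu>(2)]
            end_Vertex[OF \<eta> st] end_Vertex[OF \<xi> \<nu>(2)] by simp
        then show ?thesis using \<eta> by (simp add: cyl_def)
      next
        case False
        then show ?thesis
          using \<nu> st \<eta> bsource_if_starts_with[OF \<eta> st \<nu>(1)]
            bsource_if_starts_with[OF \<xi> \<nu>(2,1)]
          by (auto simp: cyl_def starts_with_iff)
      qed
    qed
    then have "cyl G \<xi> n = X_elem G (path_word \<nu>)"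
      unfolding X_elem_path[OF path] by (auto simp: cyl_def)
    then show ?thesis using path by blast
  qed
  have V: "cyl G \<xi> n = X_vert G (bsource G \<xi>)" if "n = 0"
    using that by (simp add: cyl_def X_vert_def)
  show thesis
  proof (cases \<xi>)
    case (Vertex v)
    have "\<eta> = \<xi>" if "\<eta> \<in> bpaths G" "bsource G \<eta> = bsource G \<xi>" for \<eta>
      using Vertex_if_bsource_sink[of \<eta>] that \<xi> Vertex by simp
    then have "cyl G \<xi> n = X_vert G (bsource G \<xi>)"
      unfolding cyl_def X_vert_def by blast
    then show ?thesis by (rule that(1))
  next
    case (FinPath p)
    then have p: "p \<in> paths G" "prange G p \<in> sinks G" "p \<noteq> []"
      using \<xi> by (simp_all add: mem_paths_iff)
    show ?thesis
    proof (cases "n = 0")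
      case False
      then have "\<exists>\<nu>\<in>paths G. cyl G \<xi> n = X_elem G (path_word \<nu>)"
        by (intro X[of "take n p"]) (use FinPath p in \<open>auto simp: take_is_prefix min_def split: if_splits\<close>)
      then show ?thesis using that(2) by blast
    qed (use V that(1) in blast)
  next
    case (InfPath x)
    show ?thesis
    proof (cases "n = 0")
      case False
      then have "\<exists>\<nu>\<in>paths G. cyl G \<xi> n = X_elem G (path_word \<nu>)"
        by (intro X[of "map x [0..<n]"]) (use InfPath in auto)
      then show ?thesis using that(2) by blast
    qed (use V that(1) in blast)
  qed
qed

text \<open>
  If no sink can be reached from \<open>v\<close>, dependent choice continues a path from \<open>v\<close> for ever.
\<close>

lemma bpath_from:
  assumes v: "v \<in> verts G"
  obtains \<eta> where "\<eta> \<in> bpaths G" "bsource G \<eta> = v"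
proof (cases "v \<in> sinks G \<or> (\<exists>p\<in>paths G. psource G p = v \<and> prange G p \<in> sinks G)")
  case True
  then show ?thesis
    using that[of "Vertex v"] that[of "FinPath _"] by auto
next
  case False
  (* The path p witnesses that e is reachable from v, so that the head of e is not a sink. *)
  let ?P = "\<lambda>n e. (n = (0::nat) \<longrightarrow> tail G e = v) \<and> (\<exists>p\<in>paths G. psource G p = v \<and> last p = e)"
  have "\<exists>x. \<forall>n. ?P n (x n) \<and> head G (x n) = tail G (x (Suc n))"
  proof (rule dependent_nat_choice)
    obtain e where e: "e \<in> arcs G" "tail G e = v"
      using False v by (auto simp: sinks_def)
    then have "[e] \<in> paths G"
      by (simp add: mem_paths_iff)
    then have "\<exists>p\<in>paths G. psource G p = v \<and> last p = e"
      by (rule bexI[rotated]) (simp add: psource_def e(2))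
    then show "\<exists>e. ?P 0 e"
      using e by blast
  next
    fix e n assume "?P n e"
    then obtain p where p: "p \<in> paths G" "psource G p = v" "last p = e"
      by blast
    then have "head G e \<in> verts G" "head G e \<notin> sinks G"
      using False by (auto simp: prange_def mem_paths_iff subset_iff intro!: head_in_verts)
    then obtain f where f: "f \<in> arcs G" "tail G f = head G e"
      by (auto simp: sinks_def)
    then have "p @ [f] \<in> paths G"
      using p by (auto simp: mem_paths_iff successively_append_iff)
    then have "\<exists>p\<in>paths G. psource G p = v \<and> last p = f"
      by (rule bexI[rotated]) (use p in \<open>simp add: psource_def mem_paths_iff\<close>)
    then show "\<exists>f. ?P (Suc n) f \<and> head G e = tail G f"
      using f by auto
  qed
  then obtain x where x: "\<And>n. ?P n (x n)" "\<And>n. head G (x n) = tail G (x (Suc n))"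
    by blast
  have "x n \<in> arcs G" for n
    using x(1)[of n] by (metis last_in_set mem_paths_iff subsetD)
  then have "InfPath x \<in> bpaths G"
    using x(2) by (simp add: inf_paths_def)
  moreover have "tail G (x 0) = v"
    using x(1)[of 0] by simp
  ultimately show ?thesis
    using that[of "InfPath x"] by simp
qed

end

section \<open>Aperiodic boundary paths\<close>

text \<open>
  No tail starting at a position \<open>q \<le> M\<close> has a period \<open>d \<le> M\<close>, and the first \<open>n\<close> edges show this. Beyond the
  end of a finite path all entries are \<^const>\<open>None\<close>, so every shift agrees there; the condition on
  position \<open>q + d - 1\<close> restricts attention to tails that contain at least one full period. With it, every
  finite path is aperiodic once \<open>n\<close> exceeds its length.
\<close>

definition aperiodic_upto :: "nat \<Rightarrow> nat \<Rightarrow> (nat \<Rightarrow> 'e option) \<Rightarrow> bool" where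
  "aperiodic_upto M n x \<longleftrightarrow> (\<forall>q d. q \<le> M \<longrightarrow> 1 \<le> d \<longrightarrow> d \<le> M \<longrightarrow> x (q + d - 1) \<noteq> None \<longrightarrow>
     (\<exists>i. q + d + i < n \<and> x (q + i) \<noteq> x (q + d + i)))"

text \<open>The margin \<open>2 * M\<close> covers the positions \<open>q + d - 1\<close>, which may exceed \<open>n\<close>.\<close>

lemma aperiodic_upto_cong:
  assumes "aperiodic_upto M n x" "\<And>i. i < n + 2 * M \<Longrightarrow> x i = z i"
  shows "aperiodic_upto M n z"
  unfolding aperiodic_upto_def
proof (intro allI impI)
  fix q d :: nat
  assume qd: "q \<le> M" "1 \<le> d" "d \<le> M" "z (q + d - 1) \<noteq> None"
  then have "x (q + d - 1) \<noteq> None"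
    using assms(2)[of "q + d - 1"] by simp
  then obtain i where i: "q + d + i < n" "x (q + i) \<noteq> x (q + d + i)"
    using assms(1) qd unfolding aperiodic_upto_def by blast
  then show "\<exists>i. q + d + i < n \<and> z (q + i) \<noteq> z (q + d + i)"
    using assms(2)[of "q + i"] assms(2)[of "q + d + i"] by auto
qed

lemma aperiodic_upto_bound:
  assumes "\<And>q d. \<lbrakk>q \<le> M; 1 \<le> d; d \<le> M; x (q + d - 1) \<noteq> None\<rbrakk> \<Longrightarrow>
    \<exists>i. x (q + i) \<noteq> x (q + d + i)"
  obtains n where "aperiodic_upto M n x"
proof -
  have "\<exists>i. q \<le> M \<longrightarrow> 1 \<le> d \<longrightarrow> d \<le> M \<longrightarrow> x (q + d - 1) \<noteq> None \<longrightarrow> x (q + i) \<noteq> x (q + d + i)" for q d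
    using assms by blast
  then obtain k where k: "\<And>q d. \<lbrakk>q \<le> M; 1 \<le> d; d \<le> M; x (q + d - 1) \<noteq> None\<rbrakk> \<Longrightarrow>
      x (q + k q d) \<noteq> x (q + d + k q d)"
    by metis
  let ?A = "(\<lambda>(q, d). q + d + k q d) ` ({..M} \<times> {..M})"
  have "q + d + k q d < Suc (Max ?A)" if "q \<le> M" "d \<le> M" for q d
    using that by (intro le_imp_less_Suc Max_ge) (auto intro!: image_eqI[of _ _ "(q, d)"])
  then have "aperiodic_upto M (Suc (Max ?A)) x"
    using k unfolding aperiodic_upto_def by blast
  then show thesis ..
qed

text \<open>
  Here \<open>x'\<close> is \<open>x\<close> with its initial segment \<open>a\<close> replaced by \<open>b\<close>, and \<open>z'\<close> is \<open>z\<close> with \<open>a'\<close> replaced by \<open>b'\<close>.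
  Both \<open>b\<close> and \<open>b'\<close> start the common part of \<open>x'\<close> and \<open>z'\<close>, so \<open>b = b' g\<close>. Since \<open>x'\<close> and \<open>z'\<close> agree, the tail of \<open>x\<close> after \<open>a\<close> is that of \<open>x'\<close> after \<open>b\<close>, which is that of \<open>z\<close>, hence
  of \<open>x\<close>, after \<open>a' g\<close>. Both \<open>a\<close> and \<open>a' g\<close> are initial segments of \<open>x\<close>. If their lengths differed, \<open>x\<close> would
  have a periodic tail with the difference as period.
\<close>

lemma quot_word_common_suffix:
  assumes ap: "aperiodic_upto (2 * N) n x"
    and len: "length a \<le> N" "length b \<le> N" "length a' \<le> N" "length b' \<le> N"
    and x: "\<And>i. i < length a \<Longrightarrow> x i = Some (a ! i)"
    and x': "\<And>i. i < length b \<Longrightarrow> x' i = Some (b ! i)" "\<And>i. x' (i + length b) = x (i + length a)"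
    and z: "\<And>i. i < length a' \<Longrightarrow> z i = Some (a' ! i)"
    and z': "\<And>i. i < length b' \<Longrightarrow> z' i = Some (b' ! i)" "\<And>i. z' (i + length b') = z (i + length a')"
    and xz: "\<And>i. i < n + 4 * N \<Longrightarrow> x i = z i" "\<And>i. i < n + 4 * N \<Longrightarrow> x' i = z' i"
    and le: "length b' \<le> length b"
  obtains g where "a = a' @ g" "b = b' @ g"
proof -
  let ?g = "drop (length b') b"
  let ?l = "length (a' @ ?g)"
  have "b' = take (length b') b"
  proof (rule nth_equalityI)
    fix i assume "i < length b'"
    then show "b' ! i = take (length b') b ! i"
      using x'(1)[of i] z'(1)[of i] xz(2)[of i] le len by simp
  qed (use le in simp)
  then have b: "b = b' @ ?g"
    by (metis append_take_drop_id)
  have pre: "x i = Some ((a' @ ?g) ! i)" if i: "i < ?l" for i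
  proof (cases "i < length a'")
    case True
    then show ?thesis using z[of i] xz(1)[of i] len by (simp add: nth_append)
  next
    case False
    define j where "j = i - length a'"
    have ij: "i = j + length a'" and j: "j + length b' < length b"
      using False i le by (simp_all add: j_def)
    have "x i = z (j + length a')"
      using xz(1)[of i] ij j len by simp
    also have "\<dots> = z' (j + length b')"
      by (simp add: z'(2))
    also have "\<dots> = x' (j + length b')"
      using xz(2)[of "j + length b'"] j len by simp
    also have "\<dots> = Some (b ! (length b' + j))"
      using x'(1)[OF j] by (simp add: add.commute)
    finally show ?thesis
      using ij le by (simp add: nth_append)
  qed
  have shift: "x (?l + i) = x (length a + i)" if "i < n" for i
  proof -
    have l: "?l + i = (length b - length b' + i) + length a'"
      using le by simp
    have "x (?l + i) = z ((length b - length b' + i) + length a')"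
    proof -
      have "?l + i < n + 4 * N"
        using that len by simp
      from xz(1)[OF this] show ?thesis
        by (metis l)
    qed
    also have "\<dots> = z' ((length b - length b' + i) + length b')"
      by (simp only: z'(2))
    also have "\<dots> = z' (i + length b)"
      using le by (simp add: add.commute)
    also have "\<dots> = x' (i + length b)"
      using xz(2)[of "i + length b"] that len by simp
    also have "\<dots> = x (length a + i)"
      by (simp add: x'(2) add.commute)
    finally show ?thesis .
  qed
  have no_period: False
    if qd: "q < q'" "q' \<le> 2 * N" "x (q' - 1) \<noteq> None" "\<And>i. i < n \<Longrightarrow> x (q + i) = x (q' + i)" for q q'
  proof -
    have "q \<le> 2 * N" "1 \<le> q' - q" "q' - q \<le> 2 * N" "x (q + (q' - q) - 1) \<noteq> None"
      using qd by auto
    then obtain i where "q + (q' - q) + i < n" "x (q + i) \<noteq> x (q + (q' - q) + i)"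
      using ap unfolding aperiodic_upto_def by blast
    then show False using qd by simp
  qed
  have "\<not> ?l < length a"
  proof
    assume lt: "?l < length a"
    show False
    proof (rule no_period[OF lt])
      show "x (length a - 1) \<noteq> None"
        using x[of "length a - 1"] lt by simp
    qed (use len shift in auto)
  qed
  moreover have "\<not> length a < ?l"
  proof
    assume lt: "length a < ?l"
    show False
    proof (rule no_period[OF lt])
      show "x (?l - 1) \<noteq> None"
        using pre[of "?l - 1"] lt by simp
      show "?l \<le> 2 * N"
        using len by simp
      show "x (length a + i) = x (?l + i)" if "i < n" for i
        using shift[OF that] by simp
    qed
  qed
  ultimately have "?l = length a"
    by linarith
  then have "a = a' @ ?g"
    using x pre by (intro nth_equalityI) auto
  then show thesis using that b by blast
qed

text \<open>
  The previous lemma applies in one of the two orders, and a nonempty common suffix would cancel in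
  \<open>a b\<^sup>-\<^sup>1\<close> or in \<open>a' b'\<^sup>-\<^sup>1\<close>.
\<close>

lemma quot_word_eq_if_edges_agree:
  assumes ap: "aperiodic_upto (2 * N) n x"
    and len: "length a \<le> N" "length b \<le> N" "length a' \<le> N" "length b' \<le> N"
    and x: "\<And>i. i < length a \<Longrightarrow> x i = Some (a ! i)"
    and x': "\<And>i. i < length b \<Longrightarrow> x' i = Some (b ! i)" "\<And>i. x' (i + length b) = x (i + length a)"
    and z: "\<And>i. i < length a' \<Longrightarrow> z i = Some (a' ! i)"
    and z': "\<And>i. i < length b' \<Longrightarrow> z' i = Some (b' ! i)" "\<And>i. z' (i + length b') = z (i + length a')"
    and xz: "\<And>i. i < n + 4 * N \<Longrightarrow> x i = z i" "\<And>i. i < n + 4 * N \<Longrightarrow> x' i = z' i"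
    and red: "reduced (quot_word a b)" "reduced (quot_word a' b')"
  shows "a = a' \<and> b = b'"
proof (cases "length b' \<le> length b")
  case True
  obtain g where "a = a' @ g" "b = b' @ g"
    by (rule quot_word_common_suffix[OF ap len x x' z z' xz True]) auto
  then show ?thesis
    using red by (cases "g = []") (auto simp: reduced_quot_word_iff)
next
  case False
  have "aperiodic_upto (2 * N) n z"
    by (rule aperiodic_upto_cong[OF ap]) (use xz in simp)
  then obtain g where "a' = a @ g" "b' = b @ g"
    by (rule quot_word_common_suffix[OF _ len(3,4,1,2) z z' x x' xz[symmetric]])
      (use False in auto)
  then show ?thesis
    using red by (cases "g = []") (auto simp: reduced_quot_word_iff)
qed

context wf_digraph
begin

text \<open>
  If \<open>\<xi>\<^sub>0\<close> itself has a periodic early tail, it is infinite and repeats a closed path \<open>c\<close> of length \<open>d\<close>. Follow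
  \<open>\<xi>\<^sub>0\<close> up to a late position \<open>r\<close>, take an exit \<open>f\<close> of \<open>c\<close> there and continue arbitrarily to a boundary path \<open>\<xi>\<close>.
  Suppose an early tail of \<open>\<xi>\<close> had a period \<open>d' \<le> M\<close>. Position \<open>r - d' d\<close> differs from \<open>r\<close> by a multiple of
  both periods, so \<open>f\<close>, which is the edge of \<open>\<xi>\<close> at \<open>r\<close>, would be its edge at \<open>r - d' d\<close>; this is the edge of \<open>\<xi>\<^sub>0\<close>
  there, hence also the edge of \<open>\<xi>\<^sub>0\<close> at \<open>r\<close>, which the exit avoids.
\<close>

lemma exists_aperiodic_in_cyl:
  assumes L: "condition_L G" and \<xi>\<^sub>0: "\<xi>\<^sub>0 \<in> bpaths G"
  obtains \<xi> n where "\<xi> \<in> cyl G \<xi>\<^sub>0 m" "aperiodic_upto M n (edge_at \<xi>)"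
proof (cases "\<exists>q d. q \<le> M \<and> 1 \<le> d \<and> d \<le> M \<and> edge_at \<xi>\<^sub>0 (q + d - 1) \<noteq> None \<and>
    (\<forall>i. edge_at \<xi>\<^sub>0 (q + i) = edge_at \<xi>\<^sub>0 (q + d + i))")
  case False
  then obtain n where "aperiodic_upto M n (edge_at \<xi>\<^sub>0)"
    using aperiodic_upto_bound[of M "edge_at \<xi>\<^sub>0"] by blast
  then show ?thesis
    using that[of \<xi>\<^sub>0] \<xi>\<^sub>0 by (simp add: cyl_def)
next
  case True
  then obtain q d where qd: "q \<le> M" "1 \<le> d" "d \<le> M"
    and def: "edge_at \<xi>\<^sub>0 (q + d - 1) \<noteq> None"
    and per: "\<And>i. edge_at \<xi>\<^sub>0 (q + i) = edge_at \<xi>\<^sub>0 (q + d + i)"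
    by blast
  obtain x where x: "\<xi>\<^sub>0 = InfPath x"
  proof (cases \<xi>\<^sub>0)
    case (FinPath p)
    then have "q + d \<le> length p"
      using def qd by (auto split: if_splits)
    then have "edge_at \<xi>\<^sub>0 (q + (length p - q - d)) \<noteq> None"
      "edge_at \<xi>\<^sub>0 (q + d + (length p - q - d)) = None"
      using FinPath qd by auto
    then show ?thesis using per by metis
  qed (use def in auto)
  have arc: "x i \<in> arcs G" "head G (x i) = tail G (x (Suc i))" for i
    using \<xi>\<^sub>0 x by (simp_all add: inf_paths_def)
  have per1: "x (i + d) = x i" if "q \<le> i" for i
    using per[of "i - q"] x that by (simp add: add.commute add.left_commute)
  have perk: "x (i + k * d) = x i" if "q \<le> i" for i k
  proof (induction k)
    case (Suc k)
    then show ?case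
      using per1[of "i + k * d"] that by (simp add: add.commute add.left_commute)
  qed simp
  let ?c = "map x [q..<q + d]"
  have "?c \<in> paths G"
    using qd arc by (auto simp: mem_paths_iff successively_conv_nth)
  moreover have "psource G ?c = prange G ?c"
    using qd arc(2)[of "q + d - 1"] per1[of q]
    by (simp add: psource_def prange_def hd_map last_map)
  ultimately obtain j f where jf: "j < d" "f \<in> arcs G" "f \<noteq> x (q + j)" "tail G f = tail G (x (q + j))"
    using L unfolding condition_L_def by force
  (* r is late enough to keep m edges and to leave room for r - d' * d beyond both tails. *)
  define r where "r = q + j + (m + M * M + M + 1) * d"
  have xr: "x r = x (q + j)"
    unfolding r_def by (rule perk) simp
  have "1 * (m + M * M + M + 1) \<le> d * (m + M * M + M + 1)"
    using qd by (intro mult_le_mono1) simp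
  then have r: "m + M * M + M + 1 \<le> r"
    by (simp add: r_def mult.commute)
  let ?a = "map x [0..<r] @ [f]"
  obtain \<eta> where \<eta>: "\<eta> \<in> bpaths G" "bsource G \<eta> = head G f"
    using bpath_from[of "head G f"] jf by auto
  have "head G (x (r - 1)) = tail G f"
    using arc(2)[of "r - 1"] r jf xr by simp
  then have a: "?a \<in> paths G \<and> prange G ?a = bsource G \<eta>"
    using r jf arc \<eta> by (auto simp: mem_paths_iff successively_conv_nth nth_append prange_def
        less_Suc_eq)
  define \<xi> where "\<xi> = prepend ?a \<eta>"
  have edge: "edge_at \<xi> i = Some (x i)" if "i < r" for i
    using that by (simp add: \<xi>_def edge_at_prepend nth_append)
  have edge_r: "edge_at \<xi> r = Some f"
    by (simp add: \<xi>_def edge_at_prepend nth_append)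
  have "\<xi> \<in> cyl G \<xi>\<^sub>0 m"
    using prepend_in_bpaths[OF \<eta>(1), of ?a] bsource_prepend[OF \<eta>(1), of ?a] a edge r x
    by (auto simp: cyl_def \<xi>_def[symmetric] psource_def hd_append hd_map)
  moreover have "\<exists>i. edge_at \<xi> (q' + i) \<noteq> edge_at \<xi> (q' + d' + i)"
    if qd': "q' \<le> M" "1 \<le> d'" "d' \<le> M" for q' d'
  proof (rule ccontr)
    assume "\<not> ?thesis"
    then have per1': "edge_at \<xi> (q' + i) = edge_at \<xi> (q' + d' + i)" for i
      by blast
    have perk': "edge_at \<xi> (i + k * d') = edge_at \<xi> i" if "q' \<le> i" for i k
    proof (induction k)
      case (Suc k)
      then show ?case
        using per1'[of "i - q' + k * d'"] that by (simp add: add.commute add.left_commute)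
    qed simp
    let ?s = "r - d' * d"
    have "d' * d \<le> M * M" "0 < d' * d"
      using qd qd' by (auto intro: mult_le_mono)
    then have s: "q \<le> ?s" "q' \<le> ?s" "?s < r" "?s + d' * d = r"
      using r qd qd' by linarith+
    have "Some (x ?s) = edge_at \<xi> r"
      using perk'[OF s(2), of d] edge[OF s(3)] s(4) by (simp add: mult.commute)
    moreover have "x ?s = x r"
      using perk[OF s(1), of d'] s(4) by simp
    ultimately show False
      using edge_r xr jf by simp
  qed
  then obtain n where "aperiodic_upto M n (edge_at \<xi>)"
    using aperiodic_upto_bound[of M "edge_at \<xi>"] by blast
  ultimately show ?thesis by (rule that)
qed

end

section \<open>The function algebra on boundary paths\<close>

interpretation fun_space: vector_space "fun_scale :: 'k::field \<Rightarrow> ('x \<Rightarrow> 'k) \<Rightarrow> 'x \<Rightarrow> 'k"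
  by (rule vector_space_fun_scale)

lemma one_free_group: "\<one>\<^bsub>free_group A\<^esub> = []"
  by (simp add: free_group_def)

lemma carrier_free_group: "w \<in> carrier (free_group A) \<longleftrightarrow> fst ` set w \<subseteq> A \<and> reduced w"
  by (simp add: free_group_def)

text \<open>
  The sets \<open>X\<^sub>c\<close> overlap in content: that of \<open>a b\<^sup>-\<^sup>1\<close> is that of \<open>a\<close>, and that of \<open>b\<^sup>-\<^sup>1\<close> is that of a vertex. The list
  below has all of them except \<open>X\<^sub>0\<close>, and it is closed under intersection.
\<close>

definition basic_sets :: "('v, 'e) pre_digraph \<Rightarrow> ('v, 'e) bpath set set" where
  "basic_sets G = {{}} \<union> X_vert G ` verts G \<union> (\<lambda>a. X_elem G (path_word a)) ` paths G"

lemma mem_basic_sets_iff: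
  "A \<in> basic_sets G \<longleftrightarrow> A = {} \<or> (\<exists>v\<in>verts G. A = X_vert G v) \<or>
    (\<exists>a\<in>paths G. A = X_elem G (path_word a))"
  by (auto simp: basic_sets_def)

context wf_digraph
begin

lemma path_word_in_carrier:
  assumes "a \<in> paths G"
  shows "path_word a \<in> carrier (free_group (arcs G))" "path_word a \<noteq> []"
proof -
  have "reduced (path_word a)"
    using reduced_quot_word_iff[of a "[]"] by (simp add: quot_word_Nil_right)
  then show "path_word a \<in> carrier (free_group (arcs G))"
    using assms by (auto simp: carrier_free_group mem_paths_iff path_word_def)
  show "path_word a \<noteq> []"
    using assms by (simp add: mem_paths_iff path_word_def)
qed

lemma X_elem_in_basic_sets:
  assumes red: "reduced p" and "p \<noteq> []"
  shows "X_elem G p \<in> basic_sets G"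
proof (cases "X_elem G p = {}")
  case False
  then obtain \<zeta> where \<zeta>: "\<zeta> \<in> X_elem G p"
    by blast
  then obtain a b where p: "p = quot_word a b"
    using X_elem_quot_wordE by blast
  note iff = mem_X_elem_quot_word_iff[OF red[unfolded p]]
  show ?thesis
  proof (cases "a = []")
    case True
    then have b: "b \<in> paths G"
      using \<zeta> \<open>p \<noteq> []\<close> unfolding p iff by (auto simp: quot_word_Nil_right path_word_def)
    then have "X_elem G p = X_vert G (prange G b)"
      using True X_elem_word_inv_path_word[OF b] by (simp add: p quot_word_Nil_left)
    moreover have "prange G b \<in> verts G"
      using b by (auto simp: prange_def mem_paths_iff subset_iff intro!: head_in_verts)
    ultimately show ?thesis
      by (auto simp: basic_sets_def)
  next
    case False
    have a: "a \<in> paths G"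
      using \<zeta> False path_if_starts_with[of \<zeta> a] unfolding p iff by blast
    have "b = [] \<or> b \<in> paths G \<and> prange G b = prange G a"
      using \<zeta> False bsource_remove_initial[of \<zeta> a] unfolding p iff by auto
    then have "X_elem G p = X_elem G (path_word a)"
      using False bsource_remove_initial[of _ a] unfolding X_elem_path[OF a] p set_eq_iff iff
      by auto
    then show ?thesis
      using a by (auto simp: basic_sets_def)
  qed
qed (simp add: basic_sets_def)

lemma basic_sets_Int:
  assumes "A \<in> basic_sets G" "B \<in> basic_sets G"
  shows "A \<inter> B \<in> basic_sets G"
proof -
  have vert_path: "X_vert G v \<inter> X_elem G (path_word a) \<in> basic_sets G" if a: "a \<in> paths G" for v a
  proof -
    have "X_vert G v \<inter> X_elem G (path_word a) = (if psource G a = v then X_elem G (path_word a) else {})"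
      using bsource_if_starts_with[of _ a] a unfolding X_elem_path[OF a]
      by (auto simp: X_vert_def mem_paths_iff)
    then show ?thesis
      using a by (auto simp: basic_sets_def)
  qed
  have path_path: "X_elem G (path_word a) \<inter> X_elem G (path_word b) \<in> basic_sets G"
    if ab: "a \<in> paths G" "b \<in> paths G" "length a \<le> length b" for a b
  proof (cases "X_elem G (path_word a) \<inter> X_elem G (path_word b) = {}")
    case False
    then obtain \<zeta> :: "('a, 'b) bpath" where "starts_with a \<zeta>" "starts_with b \<zeta>"
      using ab by (auto simp: X_elem_path)
    then have "a ! i = b ! i" if "i < length a" for i
      using that ab(3) unfolding starts_with_iff by (metis option.inject order_less_le_trans)
    then have "X_elem G (path_word a) \<inter> X_elem G (path_word b) = X_elem G (path_word b)"
      using ab(3) unfolding X_elem_path[OF ab(1)] X_elem_path[OF ab(2)] by (auto simp: starts_with_iff)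
    then show ?thesis
      using ab by (auto simp: basic_sets_def)
  qed (simp add: basic_sets_def)
  have vert_vert: "X_vert G v \<inter> X_vert G w = (if v = w then X_vert G v else {})" for v w
    by (auto simp: X_vert_def)
  have path_path': "X_elem G (path_word a) \<inter> X_elem G (path_word b) \<in> basic_sets G"
    if "a \<in> paths G" "b \<in> paths G" for a b
    using path_path[of a b] path_path[of b a] that by (metis Int_commute nat_le_linear)
  have basic: "{} \<in> basic_sets G" "\<And>v. v \<in> verts G \<Longrightarrow> X_vert G v \<in> basic_sets G"
    by (simp_all add: basic_sets_def)
  have path_vert: "X_elem G (path_word a) \<inter> X_vert G v \<in> basic_sets G" if "a \<in> paths G" for v a
    using vert_path[OF that] by (simp add: Int_commute)
  show ?thesis
    using assms[unfolded mem_basic_sets_iff]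
    by (elim disjE bexE) (simp_all add: basic vert_vert vert_path path_path' path_vert)
qed

lemma cyl_in_basic_sets: "\<xi> \<in> bpaths G \<Longrightarrow> cyl G \<xi> n \<in> basic_sets G"
  by (rule cyl_cases[of \<xi> n]) (auto simp: basic_sets_def bsource_in_verts)

lemma D0_eq_span_basic_sets:
  "(D0 G :: (('a, 'b) bpath \<Rightarrow> 'k::field) set) = fun_space.span (indicator ` basic_sets G)"
proof
  have gen: "indicator ` basic_sets G \<subseteq> (D0 G :: (('a, 'b) bpath \<Rightarrow> 'k) set)"
  proof -
    have "indicator A \<in> (D0 G :: (('a, 'b) bpath \<Rightarrow> 'k) set)" if A: "A \<in> basic_sets G" for A
    proof -
      consider "A = {}" | v where "v \<in> verts G" "A = X_vert G v"
        | a where "a \<in> paths G" "A = X_elem G (path_word a)"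
        using A unfolding mem_basic_sets_iff by blast
      then show ?thesis
      proof cases
        case 1
        then have "(indicator A :: ('a, 'b) bpath \<Rightarrow> 'k) = 0"
          by (simp add: fun_eq_iff)
        moreover have "(0 :: ('a, 'b) bpath \<Rightarrow> 'k) \<in> D0 G"
          unfolding D0_def by (rule fun_space.span_zero)
        ultimately show ?thesis by simp
      next
        case 2
        then show ?thesis
          unfolding D0_def by (intro fun_space.span_base UnI2) blast
      next
        case 3
        then show ?thesis
          unfolding D0_def one_free_group using path_word_in_carrier[OF 3(1)]
          by (intro fun_space.span_base UnI1) blast
      qed
    qed
    then show ?thesis by blast
  qed
  show "fun_space.span (indicator ` basic_sets G) \<subseteq> (D0 G :: (('a, 'b) bpath \<Rightarrow> 'k) set)"
    using gen unfolding D0_def by (intro fun_space.span_minimal fun_space.subspace_span)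
  show "(D0 G :: (('a, 'b) bpath \<Rightarrow> 'k) set) \<subseteq> fun_space.span (indicator ` basic_sets G)"
    unfolding D0_def
  proof (rule fun_space.span_mono, safe)
    fix p assume "p \<in> carrier (free_group (arcs G))"
      "(indicator (X_elem G p) :: ('a, 'b) bpath \<Rightarrow> 'k) \<notin> indicator ` basic_sets G"
    then show "p = \<one>\<^bsub>free_group (arcs G)\<^esub>"
      using X_elem_in_basic_sets[of p] by (auto simp: one_free_group carrier_free_group)
  next
    fix v assume "v \<in> verts G"
    then show "(indicator (X_vert G v) :: ('a, 'b) bpath \<Rightarrow> 'k) \<in> indicator ` basic_sets G"
      by (auto simp: basic_sets_def)
  qed
qed

lemma subspace_D0: "fun_space.subspace (D0 G)"
  by (simp add: D0_eq_span_basic_sets)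

lemma indicator_in_D0: "A \<in> basic_sets G \<Longrightarrow> indicator A \<in> D0 G"
  unfolding D0_eq_span_basic_sets by (intro fun_space.span_base) blast

text \<open>Induction over the spanning set.\<close>

lemma D0_subset:
  assumes "fun_space.subspace S" "\<And>A. A \<in> basic_sets G \<Longrightarrow> indicator A \<in> S"
  shows "D0 G \<subseteq> S"
  unfolding D0_eq_span_basic_sets using assms by (intro fun_space.span_minimal) auto

lemma basic_mult_D0:
  fixes f :: "('a, 'b) bpath \<Rightarrow> 'k::field"
  assumes A: "A \<in> basic_sets G" and f: "f \<in> D0 G"
  shows "indicator A * f \<in> D0 G"
proof -
  have "D0 G \<subseteq> {f :: ('a, 'b) bpath \<Rightarrow> 'k. indicator A * f \<in> D0 G}"
  proof (rule D0_subset)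
    have "indicator A * fun_scale c f = fun_scale c (indicator A * f)" for c :: 'k and f :: "('a, 'b) bpath \<Rightarrow> 'k"
      by (simp add: fun_scale_def fun_eq_iff)
    then show "fun_space.subspace {f :: ('a, 'b) bpath \<Rightarrow> 'k. indicator A * f \<in> D0 G}"
      using subspace_D0 unfolding fun_space.subspace_def
      by (auto simp: distrib_left)
    have AB: "(indicator A :: ('a, 'b) bpath \<Rightarrow> 'k) * indicator B = indicator (A \<inter> B)" for B
      by (simp add: fun_eq_iff indicator_inter_arith)
    fix B assume "B \<in> basic_sets G"
    then show "(indicator B :: ('a, 'b) bpath \<Rightarrow> 'k) \<in> {f. indicator A * f \<in> D0 G}"
      using indicator_in_D0[OF basic_sets_Int[OF A], of B]
      by (simp add: AB)
  qed
  then show ?thesis using f by blast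
qed

lemma D0_eq_0_outside:
  assumes "f \<in> D0 G" "\<xi> \<notin> bpaths G"
  shows "f \<xi> = (0 :: 'k::field)"
proof -
  have "D0 G \<subseteq> {f :: ('a, 'b) bpath \<Rightarrow> 'k. f \<xi> = 0}"
    by (rule D0_subset)
      (use assms(2) in \<open>auto simp: fun_space.subspace_def fun_scale_def basic_sets_def
        X_vert_def X_elem_def indicator_def\<close>)
  then show ?thesis using assms(1) by blast
qed

text \<open>
  Membership in a basic set is decided by the source and finitely many edges, and this property of a
  function survives linear combinations.
\<close>

lemma D0_locally_constant:
  fixes f :: "('a, 'b) bpath \<Rightarrow> 'k::field"
  assumes "f \<in> D0 G" and \<xi>: "\<xi> \<in> bpaths G"
  obtains n where "\<And>\<eta>. \<eta> \<in> cyl G \<xi> n \<Longrightarrow> f \<eta> = f \<xi>"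
proof -
  let ?S = "{f :: ('a, 'b) bpath \<Rightarrow> 'k. \<exists>n. \<forall>\<eta>\<in>cyl G \<xi> n. f \<eta> = f \<xi>}"
  have "D0 G \<subseteq> ?S"
  proof (rule D0_subset)
    have "f + g \<in> ?S" if fg: "f \<in> ?S" "g \<in> ?S" for f g
    proof -
      obtain m n where "\<forall>\<eta>\<in>cyl G \<xi> m. f \<eta> = f \<xi>" "\<forall>\<eta>\<in>cyl G \<xi> n. g \<eta> = g \<xi>"
        using fg by blast
      then have "\<forall>\<eta>\<in>cyl G \<xi> (max m n). (f + g) \<eta> = (f + g) \<xi>"
        by (simp add: cyl_def)
      then show ?thesis by blast
    qed
    moreover have "fun_scale c f \<in> ?S" if "f \<in> ?S" for c f
      using that unfolding fun_scale_def by auto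
    ultimately show "fun_space.subspace ?S"
      unfolding fun_space.subspace_def by simp
    fix A assume "A \<in> basic_sets G"
    then consider "A = {}" | v where "A = X_vert G v"
        | a where "a \<in> paths G" "A = X_elem G (path_word a)"
        unfolding mem_basic_sets_iff by blast
    then have "\<exists>n. \<forall>\<eta>\<in>cyl G \<xi> n. \<eta> \<in> A \<longleftrightarrow> \<xi> \<in> A"
    proof cases
      case 2
      then show ?thesis using \<xi> by (auto simp: cyl_def X_vert_def)
    next
      case 3
      then have "\<forall>\<eta>\<in>cyl G \<xi> (length a). \<eta> \<in> A \<longleftrightarrow> \<xi> \<in> A"
        using \<xi> by (auto simp: cyl_def X_elem_path starts_with_iff)
      then show ?thesis by blast
    qed simp
    then show "indicator A \<in> ?S"
      by (auto simp: indicator_def)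
  qed
  then show thesis using assms(1) that by blast
qed

end

section \<open>Computing in the partial skew group ring\<close>

context wf_digraph
begin

text \<open>
  The separate clause for the neutral element agrees with the general one, because functions in \<open>D\<^sub>0\<close> vanish
  outside the boundary path space.
\<close>

lemma mem_D_iff:
  fixes f :: "('a, 'b) bpath \<Rightarrow> 'k::field"
  shows "f \<in> D G p \<longleftrightarrow> (\<exists>g\<in>D0 G. f = indicator (X_elem G p) * g)"
proof (cases "p = []")
  case True
  have "indicator (bpaths G) * g = g" if "g \<in> D0 G" for g :: "('a, 'b) bpath \<Rightarrow> 'k"
    using D0_eq_0_outside[OF that] by (auto simp: fun_eq_iff indicator_def)
  then show ?thesis
    using True by (auto simp: D_def one_free_group X_elem_one intro: bexI[rotated])
qed (auto simp: D_def one_free_group)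

lemma D_eq_0_outside: "\<lbrakk>f \<in> D G p; \<xi> \<notin> X_elem G p\<rbrakk> \<Longrightarrow> f \<xi> = 0"
  by (auto simp: mem_D_iff)

lemma D_subset_D0:
  assumes "reduced p"
  shows "D G p \<subseteq> D0 G"
  using basic_mult_D0[OF X_elem_in_basic_sets[OF assms]]
  by (cases "p = []") (auto simp: D_def one_free_group)

lemma D_diff:
  assumes "f \<in> D G p" "g \<in> D G p"
  shows "f - g \<in> D G p"
  using assms fun_space.subspace_diff[OF subspace_D0]
  unfolding mem_D_iff by (metis right_diff_distrib)

lemma zero_in_D: "0 \<in> D G p"
  using fun_space.subspace_0[OF subspace_D0]
  unfolding mem_D_iff by (metis mult_zero_right)

lemma basic_mult_D:
  assumes "A \<in> basic_sets G" "f \<in> D G p"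
  shows "indicator A * f \<in> D G p"
  using assms basic_mult_D0 unfolding mem_D_iff by (metis mult.left_commute)

lemma indicator_in_D:
  assumes "A \<in> basic_sets G" "A \<subseteq> X_elem G p"
  shows "indicator A \<in> D G p"
proof -
  have "indicator A = indicator (X_elem G p) * (indicator A :: _ \<Rightarrow> 'k::field)"
    using assms(2) by (auto simp: fun_eq_iff indicator_def)
  then show ?thesis
    using indicator_in_D0[OF assms(1)] unfolding mem_D_iff by blast
qed

lemma indicator_in_D_one: "A \<in> basic_sets G \<Longrightarrow> indicator A \<in> D G []"
  by (simp add: D_def one_free_group indicator_in_D0)

lemma skew_ring_iff:
  fixes x :: "('a, 'b, 'c::field) skew"
  shows "x \<in> skew_ring G \<longleftrightarrow> (\<forall>t. Poly_Mapping.lookup x t \<in> D G t \<and>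
     (Poly_Mapping.lookup x t \<noteq> 0 \<longrightarrow> t \<in> carrier (free_group (arcs G))))"
proof -
  have "f \<in> D G t" if "f = 0" for f :: "('a, 'b) bpath \<Rightarrow> 'c::field" and t
    using zero_in_D that by simp
  then show ?thesis
    unfolding skew_ring_def by (auto simp: in_keys_iff)
qed

lemma skew_ring_diff:
  "\<lbrakk>x \<in> skew_ring G; y \<in> skew_ring G\<rbrakk> \<Longrightarrow> x - y \<in> skew_ring G"
  unfolding skew_ring_iff lookup_minus using D_diff by (metis diff_self)

lemma single_in_skew_ring:
  "\<lbrakk>t \<in> carrier (free_group (arcs G)); f \<in> D G t\<rbrakk> \<Longrightarrow> Poly_Mapping.single t f \<in> skew_ring G"
  unfolding skew_ring_iff by (auto simp: lookup_single when_def zero_in_D)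

text \<open>
  Evaluating the twisted product pointwise. Moving \<open>f\<close> forth and back leaves it unchanged, since it
  is supported where the map of \<open>t\<^sup>-\<^sup>1\<close> is defined; only \<open>g\<close> is moved by the action.
\<close>

lemma alpha_alpha_mult:
  assumes "t \<in> carrier (free_group (arcs G))" "f \<in> D G t"
  shows "alpha G t (alpha G (inv\<^bsub>free_group (arcs G)\<^esub> t) f * g) =
    (\<lambda>\<zeta>. f \<zeta> * g (theta G (word_inv t) \<zeta>))"
proof
  fix \<zeta>
  have red: "reduced t"
    using assms(1) by (simp add: carrier_free_group)
  have inv: "inv\<^bsub>free_group (arcs G)\<^esub> t = word_inv t"
    "inv\<^bsub>free_group (arcs G)\<^esub> (word_inv t) = t"
    using assms(1) by (simp_all add: inv_free_group word_inv_closed)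
      (simp add: word_inv_def rev_map comp_def)
  show "alpha G t (alpha G (inv\<^bsub>free_group (arcs G)\<^esub> t) f * g) \<zeta> = f \<zeta> * g (theta G (word_inv t) \<zeta>)"
  proof (cases "\<zeta> \<in> X_elem G t")
    case True
    then show ?thesis
      using theta_word_inv[OF red True] by (simp add: alpha_def inv)
  next
    case False
    then show ?thesis
      using D_eq_0_outside[OF assms(2) False] by (simp add: alpha_def)
  qed
qed

text \<open>
  Arbitrary finite supersets of the supports are allowed, as the support of a product or of a single
  term need not be known exactly.
\<close>

lemma skew_mult_eq_sum:
  assumes x: "x \<in> skew_ring G" and A: "finite A" "Poly_Mapping.keys x \<subseteq> A"
    and B: "finite B" "Poly_Mapping.keys y \<subseteq> B"
  shows "skew_mult G x y = (\<Sum>t\<in>A. \<Sum>s\<in>B. Poly_Mapping.single (t \<otimes>\<^bsub>free_group (arcs G)\<^esub> s)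
    (\<lambda>\<zeta>. Poly_Mapping.lookup x t \<zeta> * Poly_Mapping.lookup y s (theta G (word_inv t) \<zeta>)))"
    (is "_ = (\<Sum>t\<in>A. \<Sum>s\<in>B. ?h t s)")
proof -
  have "skew_mult G x y = (\<Sum>t\<in>Poly_Mapping.keys x. \<Sum>s\<in>Poly_Mapping.keys y. ?h t s)"
    unfolding skew_mult_def using x
    by (intro sum.cong refl) (simp add: alpha_alpha_mult skew_ring_def)
  also have "\<dots> = (\<Sum>t\<in>Poly_Mapping.keys x. \<Sum>s\<in>B. ?h t s)"
    using B by (intro sum.cong refl sum.mono_neutral_left)
      (auto simp: in_keys_iff zero_fun_def[symmetric])
  also have "\<dots> = (\<Sum>t\<in>A. \<Sum>s\<in>B. ?h t s)"
    using A by (intro sum.mono_neutral_left)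
      (auto simp: in_keys_iff zero_fun_def[symmetric] intro!: sum.neutral)
  finally show ?thesis .
qed

lemma skew_mult_single_single:
  assumes "t \<in> carrier (free_group (arcs G))" "f \<in> D G t"
  shows "skew_mult G (Poly_Mapping.single t f) (Poly_Mapping.single s g) =
    Poly_Mapping.single (t \<otimes>\<^bsub>free_group (arcs G)\<^esub> s) (\<lambda>\<zeta>. f \<zeta> * g (theta G (word_inv t) \<zeta>))"
  using skew_mult_eq_sum[OF single_in_skew_ring[OF assms], of "{t}" "{s}" "Poly_Mapping.single s g"]
  by simp

lemma skew_mult_indicator_left:
  fixes x :: "('a, 'b, 'k::field) skew"
  assumes A: "A \<in> basic_sets G" and x: "x \<in> skew_ring G"
  shows lookup_skew_mult_indicator_left:
      "Poly_Mapping.lookup (skew_mult G (Poly_Mapping.single [] (indicator A)) x) t =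
        indicator A * Poly_Mapping.lookup x t"
    and skew_mult_indicator_left_in_skew_ring:
      "skew_mult G (Poly_Mapping.single [] (indicator A)) x \<in> skew_ring G"
proof -
  have D: "(indicator A :: _ \<Rightarrow> 'k) \<in> D G []"
    by (rule indicator_in_D_one[OF A])
  have outside: "\<zeta> \<in> bpaths G" if "\<zeta> \<in> A" for \<zeta>
    using D_eq_0_outside[OF D, of \<zeta>] that by (auto simp: X_elem_one)
  have one: "[] \<in> carrier (free_group (arcs G))"
    by (simp add: carrier_free_group)
  have mult: "[] \<otimes>\<^bsub>free_group (arcs G)\<^esub> s = s" for s
    by (simp add: free_group_def)
  have fn: "(\<lambda>\<zeta>. (indicator A \<zeta> :: 'k) * Poly_Mapping.lookup x s (theta G (word_inv []) \<zeta>)) =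
      indicator A * Poly_Mapping.lookup x s" for s
    using theta_one[OF outside] by (auto simp: fun_eq_iff indicator_def word_inv_def)
  have prod: "skew_mult G (Poly_Mapping.single [] (indicator A)) x =
      (\<Sum>s\<in>Poly_Mapping.keys x. Poly_Mapping.single s (indicator A * Poly_Mapping.lookup x s))"
    using skew_mult_eq_sum[OF single_in_skew_ring[OF one D], of "{[]}" "Poly_Mapping.keys x" x]
    by (simp add: mult fn)
  show lookup: "Poly_Mapping.lookup (skew_mult G (Poly_Mapping.single [] (indicator A)) x) t =
        indicator A * Poly_Mapping.lookup x t" for t
    unfolding prod lookup_sum lookup_single when_def
    by (auto simp: in_keys_iff)
  show "skew_mult G (Poly_Mapping.single [] (indicator A)) x \<in> skew_ring G"
    using x basic_mult_D[OF A] unfolding skew_ring_iff lookup by (metis mult_zero_right)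
qed

section \<open>The uniqueness theorem\<close>

text \<open>
  The coefficient that \<open>s\<close> contributes to the product is supported on the points of \<open>C\<close> which the map of \<open>s\<^sup>-\<^sup>1\<close>
  sends into \<open>C'\<close>. For \<open>s = t\<close> these are all points of \<open>C\<close>, because \<open>C\<close> is deeper than \<open>C'\<close> by at least the
  length of \<open>a\<close>; for \<open>s \<noteq> t\<close> there are none, because \<open>\<xi>\<close> is aperiodic.
\<close>

lemma skew_mult_collapse:
  fixes x :: "('a, 'b, 'k::field) skew"
  assumes L: "condition_L G" and x: "x \<in> skew_ring G" and "x \<noteq> 0"
  obtains \<xi> n k w where "\<xi> \<in> bpaths G" "k \<noteq> 0" "w \<in> skew_ring G"
    "skew_mult G (skew_mult G (Poly_Mapping.single [] (indicator (cyl G \<xi> n))) x) w =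
       Poly_Mapping.single [] (fun_scale k (indicator (cyl G \<xi> n)))"
proof -
  let ?F = "free_group (arcs G)"
  obtain t where "Poly_Mapping.lookup x t \<noteq> 0"
    using \<open>x \<noteq> 0\<close> by (metis lookup_zero poly_mapping_eqI)
  then have t: "t \<in> Poly_Mapping.keys x"
    by (simp add: in_keys_iff)
  have carrier: "s \<in> carrier ?F" "reduced s" "Poly_Mapping.lookup x s \<in> D G s"
    if "s \<in> Poly_Mapping.keys x" for s
    using x that by (auto simp: skew_ring_def carrier_free_group)
  define f where "f = Poly_Mapping.lookup x t"
  have "f \<noteq> 0"
    unfolding f_def by fact
  then obtain \<xi>\<^sub>0 where \<xi>\<^sub>0: "f \<xi>\<^sub>0 \<noteq> 0"
    by (auto simp: fun_eq_iff)
  have f: "f \<in> D G t" "f \<in> D0 G"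
    using carrier[OF t] D_subset_D0[of t] by (auto simp: f_def)
  have bp: "\<xi>\<^sub>0 \<in> bpaths G"
    using D0_eq_0_outside[OF f(2)] \<xi>\<^sub>0 by blast
  obtain m where m: "\<And>\<eta>. \<eta> \<in> cyl G \<xi>\<^sub>0 m \<Longrightarrow> f \<eta> = f \<xi>\<^sub>0"
    using D0_locally_constant[OF f(2) bp] by blast
  (* N bounds the lengths of the paths in the support; shifts then compare positions up to 2 * N. *)
  define N where "N = (\<Sum>s\<in>Poly_Mapping.keys x. length s)"
  have N: "length s \<le> N" if "s \<in> Poly_Mapping.keys x" for s
    unfolding N_def using that by (intro member_le_sum) auto
  obtain \<xi> n where \<xi>: "\<xi> \<in> cyl G \<xi>\<^sub>0 m" and ap: "aperiodic_upto (2 * N) n (edge_at \<xi>)"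
    using exists_aperiodic_in_cyl[OF L bp] by blast
  have \<xi>_bp: "\<xi> \<in> bpaths G"
    using \<xi> by (simp add: cyl_def)
  have \<xi>_t: "\<xi> \<in> X_elem G t"
    using D_eq_0_outside[OF f(1)] m[OF \<xi>] \<xi>\<^sub>0 by fastforce
  obtain a b where ab: "t = quot_word a b"
    using X_elem_quot_wordE[OF \<xi>_t] .
  have red: "reduced (quot_word a b)"
    using carrier(2)[OF t] ab by simp
  have len: "length a \<le> N" "length b \<le> N"
    using N[OF t] by (simp_all add: ab length_quot_word)
  define n' where "n' = n + 4 * N"
  define C where "C = cyl G \<xi> (m + n' + N)"
  define \<xi>' where "\<xi>' = theta G (quot_word b a) \<xi>"
  define C' where "C' = cyl G \<xi>' n'"
  have \<xi>'_in: "\<xi>' \<in> X_elem G (quot_word b a)"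
    using theta_word_inv_in[OF carrier(2)[OF t] \<xi>_t] by (simp add: ab word_inv_quot_word \<xi>'_def)
  then have \<xi>'_bp: "\<xi>' \<in> bpaths G"
    by (simp add: mem_X_elem_iff)
  have red': "reduced (quot_word b a)"
    using red by (auto simp: reduced_quot_word_iff)
  have wt: "quot_word b a \<in> carrier ?F"
    using word_inv_closed[OF carrier(1)[OF t]] by (simp add: ab word_inv_quot_word)
  define g where "g = indicator (X_elem G (quot_word b a)) * (indicator C' :: _ \<Rightarrow> 'k)"
  define w where "w = Poly_Mapping.single (quot_word b a) g"
  have g: "g \<in> D G (quot_word b a)"
    unfolding g_def mem_D_iff C'_def using indicator_in_D0[OF cyl_in_basic_sets[OF \<xi>'_bp]] by blast
  have w: "w \<in> skew_ring G"
    unfolding w_def by (rule single_in_skew_ring[OF wt g])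
  let ?e = "Poly_Mapping.single [] (indicator C) :: ('a, 'b, 'k) skew"
  let ?y = "skew_mult G ?e x"
  have C: "C \<in> basic_sets G"
    unfolding C_def by (rule cyl_in_basic_sets[OF \<xi>_bp])
  note lookup_y = lookup_skew_mult_indicator_left[OF C x]
  let ?h = "\<lambda>s \<zeta>. indicator C \<zeta> * Poly_Mapping.lookup x s \<zeta> * g (theta G (word_inv s) \<zeta>)"
  have "skew_mult G ?y w = (\<Sum>s\<in>Poly_Mapping.keys x. \<Sum>r\<in>{quot_word b a}.
      Poly_Mapping.single (s \<otimes>\<^bsub>?F\<^esub> r)
      (\<lambda>\<zeta>. Poly_Mapping.lookup ?y s \<zeta> * Poly_Mapping.lookup w r (theta G (word_inv s) \<zeta>)))"
  proof (rule skew_mult_eq_sum[OF skew_mult_indicator_left_in_skew_ring[OF C x]])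
    show "Poly_Mapping.keys ?y \<subseteq> Poly_Mapping.keys x"
      using lookup_y by (auto simp: in_keys_iff)
  qed (simp_all add: w_def)
  also have "\<dots> = (\<Sum>s\<in>Poly_Mapping.keys x.
      Poly_Mapping.single (s \<otimes>\<^bsub>?F\<^esub> quot_word b a) (?h s))"
    by (simp add: lookup_y w_def)
  also have "\<dots> = (\<Sum>s\<in>Poly_Mapping.keys x.
      if s = t then Poly_Mapping.single (t \<otimes>\<^bsub>?F\<^esub> quot_word b a) (?h t) else 0)"
  proof (rule sum.cong[OF refl])
    fix s assume s: "s \<in> Poly_Mapping.keys x"
    have "?h s \<zeta> = 0" if "s \<noteq> t" for \<zeta>
    proof (rule ccontr)
      assume nz: "?h s \<zeta> \<noteq> 0"
      then have "\<zeta> \<in> C" and "Poly_Mapping.lookup x s \<zeta> \<noteq> 0"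
        and "theta G (word_inv s) \<zeta> \<in> C'"
        by (auto simp: g_def indicator_def split: if_splits)
      then have \<zeta>: "\<zeta> \<in> X_elem G s"
        using D_eq_0_outside[OF carrier(3)[OF s]] by blast
      obtain a' b' where s': "s = quot_word a' b'"
        using X_elem_quot_wordE[OF \<zeta>] .
      note edges = edges_theta_word_inv[OF red \<xi>_t[unfolded ab], folded \<xi>'_def]
        edges_theta_word_inv[OF carrier(2)[OF s, unfolded s'] \<zeta>[unfolded s']]
      have "a = a' \<and> b = b'"
      proof (rule quot_word_eq_if_edges_agree[OF ap len])
        show "length a' \<le> N" "length b' \<le> N"
          using N[OF s] by (simp_all add: s' length_quot_word)
        show "edge_at \<xi> i = edge_at \<zeta> i" if "i < n + 4 * N" for i
          using \<open>\<zeta> \<in> C\<close> that by (simp add: C_def cyl_def n'_def)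
        show "edge_at \<xi>' i = edge_at (theta G (quot_word b' a') \<zeta>) i" if "i < n + 4 * N" for i
          using \<open>theta G (word_inv s) \<zeta> \<in> C'\<close> that
          by (simp add: C'_def cyl_def n'_def s' word_inv_quot_word)
        show "reduced (quot_word a b)" "reduced (quot_word a' b')"
          using red carrier(2)[OF s] by (simp_all add: s')
      qed (use edges in \<open>simp_all add: starts_with_iff\<close>)
      then show False using \<open>s \<noteq> t\<close> ab s' by simp
    qed
    then have "?h s = 0" if "s \<noteq> t"
      using that by (simp add: fun_eq_iff)
    then show "Poly_Mapping.single (s \<otimes>\<^bsub>?F\<^esub> quot_word b a) (?h s) =
        (if s = t then Poly_Mapping.single (t \<otimes>\<^bsub>?F\<^esub> quot_word b a) (?h t) else 0)"
      by simp
  qed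
  also have "\<dots> = Poly_Mapping.single (t \<otimes>\<^bsub>?F\<^esub> quot_word b a) (?h t)"
    using t by simp
  also have "t \<otimes>\<^bsub>?F\<^esub> quot_word b a = []"
    using group.r_inv[OF group_free_group carrier(1)[OF t]] inv_free_group[OF carrier(1)[OF t]]
    by (simp add: one_free_group ab word_inv_quot_word)
  also have "?h t = fun_scale (f \<xi>\<^sub>0) (indicator C)"
  proof
    fix \<zeta>
    show "?h t \<zeta> = fun_scale (f \<xi>\<^sub>0) (indicator C) \<zeta>"
    proof (cases "\<zeta> \<in> C")
      case True
      have "\<zeta> \<in> cyl G \<xi>\<^sub>0 m"
        using True \<xi> by (simp add: C_def cyl_def)
      then have f\<zeta>: "f \<zeta> = f \<xi>\<^sub>0"
        by (rule m)
      then have \<zeta>: "\<zeta> \<in> X_elem G t"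
        using D_eq_0_outside[OF f(1)] \<xi>\<^sub>0 by fastforce
      let ?\<zeta>' = "theta G (quot_word b a) \<zeta>"
      have \<zeta>': "?\<zeta>' \<in> X_elem G (quot_word b a)"
        using theta_word_inv_in[OF carrier(2)[OF t] \<zeta>] by (simp add: ab word_inv_quot_word)
      note edges = edges_theta_word_inv[OF red \<xi>_t[unfolded ab], folded \<xi>'_def]
        edges_theta_word_inv[OF red \<zeta>[unfolded ab]]
      have "edge_at ?\<zeta>' i = edge_at \<xi>' i" if "i < n'" for i
      proof (cases "i < length b")
        case True
        then show ?thesis
          using edges(2,5) by (simp add: starts_with_iff)
      next
        case False
        then have i: "i = (i - length b) + length b"
          by simp
        have "edge_at \<zeta> (i - length b + length a) = edge_at \<xi> (i - length b + length a)"
          using \<open>\<zeta> \<in> C\<close> that len False by (simp add: C_def cyl_def)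
        then show ?thesis
          using edges(3)[of "i - length b"] edges(6)[of "i - length b"] False by simp
      qed
      moreover have "bsource G ?\<zeta>' = bsource G \<xi>'"
        using bsource_theta_word_inv[OF red \<zeta>[unfolded ab]]
          bsource_theta_word_inv[OF red \<xi>_t[unfolded ab]] \<open>\<zeta> \<in> C\<close>
        by (simp add: \<xi>'_def C_def cyl_def)
      ultimately have "?\<zeta>' \<in> C'"
        using \<zeta>' by (simp add: C'_def cyl_def mem_X_elem_iff)
      then show ?thesis
        using True \<zeta>' f\<zeta> by (simp add: g_def ab word_inv_quot_word fun_scale_def f_def)
    qed (simp add: fun_scale_def)
  qed
  finally show thesis
    using that[OF \<xi>_bp \<xi>\<^sub>0 w] by (simp add: C_def)
qed

text \<open>
  Let \<open>u\<close> be \<open>1 \<delta>\<close> at \<open>\<nu>\<^sup>-\<^sup>1\<close>, \<open>w\<close> be \<open>1 \<delta>\<close> at \<open>\<nu>\<close>, and \<open>e = 1\<^sub>C \<delta>\<^sub>0\<close>. Then \<open>u e = u\<close>, while \<open>u w\<close> is the projection of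
  the range of \<open>\<nu>\<close>. In the Leavitt path algebra these are \<open>\<nu>\<^sup>*\<close>, \<open>\<nu>\<close>, \<open>\<nu> \<nu>\<^sup>*\<close> and the identity \<open>\<nu>\<^sup>* \<nu> = r(\<nu>)\<close>. If
  \<open>\<phi>\<close> killed \<open>e\<close>, it would kill \<open>u = u e\<close> and hence \<open>u w\<close>.
\<close>

lemma hom_indicator_cyl_neq_0:
  fixes \<phi> :: "('a, 'b, 'k::field) skew \<Rightarrow> 'c::ring"
  assumes mult: "\<And>x y. \<lbrakk>x \<in> skew_ring G; y \<in> skew_ring G\<rbrakk> \<Longrightarrow> \<phi> (skew_mult G x y) = \<phi> x * \<phi> y"
    and nz: "\<And>v. v \<in> verts G \<Longrightarrow> \<phi> (Poly_Mapping.single [] (indicator (X_vert G v))) \<noteq> 0"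
    and \<xi>: "\<xi> \<in> bpaths G"
  shows "\<phi> (Poly_Mapping.single [] (indicator (cyl G \<xi> n))) \<noteq> 0"
proof (cases rule: cyl_cases[OF \<xi>, of n, case_names vert path])
  case vert
  then show ?thesis using nz bsource_in_verts[OF \<xi>] by simp
next
  case (path \<nu>)
  let ?F = "free_group (arcs G)"
  let ?p = "path_word \<nu>"
  let ?q = "word_inv ?p"
  let ?ind = "\<lambda>c. (indicator (X_elem G c) :: ('a, 'b) bpath \<Rightarrow> 'k)"
  have p: "?p \<in> carrier ?F" and q: "?q \<in> carrier ?F"
    using path_word_in_carrier[OF path(1)] word_inv_closed by auto
  then have red: "reduced ?p" "reduced ?q"
    by (simp_all add: carrier_free_group)
  have ne: "?p \<noteq> []" "?q \<noteq> []"
    using path_word_in_carrier[OF path(1)] by (simp_all add: word_inv_def)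
  have inv_q: "word_inv ?q = ?p"
    by (simp add: word_inv_def rev_map comp_def)
  have X_q: "X_elem G ?q = X_vert G (prange G \<nu>)"
    by (rule X_elem_word_inv_path_word[OF path(1)])
  have v: "prange G \<nu> \<in> verts G"
    using path(1) by (auto simp: prange_def mem_paths_iff subset_iff intro!: head_in_verts)
  have fn: "(\<lambda>\<zeta>. ?ind ?q \<zeta> * ?ind ?p (theta G (word_inv ?q) \<zeta>)) = ?ind ?q"
    using theta_word_inv_in[OF red(2)] by (auto simp: fun_eq_iff indicator_def inv_q)
  have basic: "X_elem G ?p \<in> basic_sets G" "X_elem G ?q \<in> basic_sets G"
    using X_elem_in_basic_sets red ne by blast+
  have D: "?ind ?q \<in> D G ?q" "?ind ?p \<in> D G ?p" "?ind ?p \<in> D G []"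
    using indicator_in_D[OF basic(2)] indicator_in_D[OF basic(1)] indicator_in_D_one[OF basic(1)]
    by blast+
  have one: "[] \<in> carrier ?F"
    by (simp add: carrier_free_group)
  define u where "u = Poly_Mapping.single ?q (?ind ?q)"
  define e :: "('a, 'b, 'k) skew" where "e = Poly_Mapping.single [] (?ind ?p)"
  define w where "w = Poly_Mapping.single ?p (?ind ?p)"
  have in_ring: "u \<in> skew_ring G" "e \<in> skew_ring G" "w \<in> skew_ring G"
    unfolding u_def e_def w_def using single_in_skew_ring p q one D by blast+
  have "?q \<otimes>\<^bsub>?F\<^esub> [] = ?q"
    using foldr_push_Nil[OF red(2)] by (simp add: free_group_def)
  then have "skew_mult G u e = u"
    unfolding u_def e_def skew_mult_single_single[OF q D(1)] fn by simp
  then have u: "\<phi> u = \<phi> u * \<phi> e"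
    using mult[OF in_ring(1,2)] by simp
  have "?q \<otimes>\<^bsub>?F\<^esub> ?p = []"
    using word_inv_mult[OF p] by (simp add: one_free_group)
  then have "skew_mult G u w = Poly_Mapping.single [] (indicator (X_vert G (prange G \<nu>)))"
    unfolding u_def w_def skew_mult_single_single[OF q D(1)] fn by (simp add: X_q)
  then have "\<phi> u * \<phi> w \<noteq> 0"
    using mult[OF in_ring(1,3)] nz[OF v] by simp
  then have "\<phi> e \<noteq> 0"
    using u by auto
  then show ?thesis
    by (simp add: path(2) e_def)
qed

end

theorem theorem3p6:
  fixes G :: "('v, 'e) pre_digraph"
    and scaleB :: "'k::field \<Rightarrow> 'b::ring \<Rightarrow> 'b"
    and \<phi> :: "('v, 'e, 'k) skew \<Rightarrow> 'b"
  assumes "wf_digraph G"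
    and "condition_L G"
    and "k_algebra scaleB"
    and "skew_ring_hom G scaleB \<phi>"
    and "\<And>v. v \<in> verts G \<Longrightarrow>
           \<phi> (Poly_Mapping.single \<one>\<^bsub>free_group (arcs G)\<^esub> (indicator (X_vert G v))) \<noteq> 0"
  shows "inj_on \<phi> (skew_ring G)"
proof (rule inj_onI, rule ccontr)
  interpret wf_digraph G by fact
  interpret B: k_algebra scaleB by fact
  have add: "\<phi> (x + y) = \<phi> x + \<phi> y"
    and mult: "\<phi> (skew_mult G x y) = \<phi> x * \<phi> y"
    and scale: "\<phi> (skew_scale c x) = scaleB c (\<phi> x)"
    if "x \<in> skew_ring G" "y \<in> skew_ring G" for x y c
    using assms(4) that unfolding skew_ring_hom_def by blast+
  fix y z assume yz: "y \<in> skew_ring G" "z \<in> skew_ring G" "\<phi> y = \<phi> z" "y \<noteq> z"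
  define x where "x = y - z"
  have x: "x \<in> skew_ring G" "x \<noteq> 0"
    using yz skew_ring_diff by (simp_all add: x_def)
  have "\<phi> y = \<phi> x + \<phi> z"
    using add[OF x(1) yz(2)] by (simp add: x_def)
  then have "\<phi> x = 0"
    using yz by simp
  obtain \<xi> n k w where *: "\<xi> \<in> bpaths G" "k \<noteq> 0" "w \<in> skew_ring G"
    "skew_mult G (skew_mult G (Poly_Mapping.single [] (indicator (cyl G \<xi> n))) x) w =
       Poly_Mapping.single [] (fun_scale k (indicator (cyl G \<xi> n)))"
    by (rule skew_mult_collapse[OF assms(2) x])
  let ?e = "Poly_Mapping.single [] (indicator (cyl G \<xi> n)) :: ('v, 'e, 'k) skew"
  have cyl: "cyl G \<xi> n \<in> basic_sets G"
    by (rule cyl_in_basic_sets[OF *(1)])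
  have e: "?e \<in> skew_ring G"
    by (intro single_in_skew_ring indicator_in_D_one[OF cyl]) (simp add: carrier_free_group)
  have "skew_scale k ?e = skew_mult G (skew_mult G ?e x) w"
    unfolding *(4) skew_scale_def by (rule map_single) (simp add: fun_scale_def fun_eq_iff)
  then have "scaleB k (\<phi> ?e) = \<phi> (skew_mult G (skew_mult G ?e x) w)"
    using scale[OF e e, of k] by simp
  also have "\<dots> = \<phi> ?e * \<phi> x * \<phi> w"
    using mult[OF skew_mult_indicator_left_in_skew_ring[OF cyl x(1)] *(3)] mult[OF e x(1)] by simp
  finally have "scaleB k (\<phi> ?e) = 0"
    using \<open>\<phi> x = 0\<close> by simp
  then have "\<phi> ?e = 0"
    using *(2) by simp
  moreover have "\<phi> ?e \<noteq> 0"
    using assms(5) by (intro hom_indicator_cyl_neq_0[OF mult _ *(1)]) (simp_all add: one_free_group)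
  ultimately show False by simp
qed

end
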